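(* Let $n=2m$ be an even positive integer and $\mathbf{x}=(x_1,\dots,x_n)\in(0,\infty)^n$. Then $$E(\mathbf{x})=\sum_{k\in\{2,4,\dots,n\}}\ \sum_{\mathbf{o}\in\mathcal{O}_k}P(\mathbf{o})\,f(\mathbf{o},\mathbf{x}),$$ with $E$, $\mathcal{O}_k$, $P$ and $f$ as defined in the context.
   Context: For $\mathbf{x}=(x_1,\dots,x_n)\in(0,\infty)^n$ with $n=2m$, let $\mathcal{C}(\mathbf{x})$ be the configuration of $n+1$ points $P_1<\dots<P_{n+1}$ on $\mathbb{R}$ with $P_1=0$ and $P_{i+1}=P_i+x_i$, where $P_i$ is red if $i$ is odd and blue if $i$ is even ($m+1$ red and $m$ blue points). A matching $\mathcal{M}$ of this configuration is produced by the algorithm which repeatedly selects, among all pairs consisting of an unmatched blue point and an unmatched red point, a pair at minimum distance, and matches them, until no further matching is possible; ties are broken at random. $D(\mathbf{x})$ is the expected value of $\sum_{P\text{ blue}}|P-\mathcal{M}(P)|$ with respect to the randomness of this algorithm. For a permutation $\pi$ of $\{1,\dots,n\}$ write $\pi(\mathbf{x})=(x_{\pi(1)},\dots,x_{\pi(n)})$, and define $E(\mathbf{x})=\frac{1}{n!}\sum_{\pi}D(\pi(\mathbf{x}))$. For a positive integer $k$, $\mathcal{O}_k$ is the set of all multisets $\mathbf{o}=\{o_1,\dots,o_r\}$ of odd positive integers with $\sum_{i=1}^r o_i=k$; $c(\mathbf{o},i)$ is the number of times $i$ appears in $\mathbf{o}$, and $P(\mathbf{o})=\dfrac{2^{r-1}}{\prod_{i=1}^k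 i^{c(\mathbf{o},i)}c(\mathbf{o},i)!}$. For $\mathbf{o}\in\mathcal{O}_k$ with $k\le n$, $\Phi(\mathbf{o},\mathbf{x})$ is the set of all ways to choose an unordered collection of pairwise disjoint subsets $S_1,\dots,S_r$ of the index set $\{1,\dots,n\}$ with sizes $o_1,\dots,o_r$ (so $|\Phi(\mathbf{o},\mathbf{x})|=\frac{n!}{(n-k)!\prod_{i=1}^r o_i!\prod_{i=1}^k c(\mathbf{o},i)!}$), and $f(\mathbf{o},\mathbf{x})=\frac{1}{|\Phi(\mathbf{o},\mathbf{x})|}\sum_{\{S_1,\dots,S_r\}\in\Phi(\mathbf{o},\mathbf{x})}\min\bigl(\sum_{i\in S_1}x_i,\dots,\sum_{i\in S_r}x_i\bigr)$. *)

theory Defs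
  imports "HOL-Library.Multiset" "HOL-Combinatorics.Permutations" Complex_Main
begin

definition pt_pos :: "(nat \<Rightarrow> real) \<Rightarrow> nat \<Rightarrow> real" where
  "pt_pos x i = (\<Sum>j\<in>{1..<i}. x j)"

definition red_pts :: "nat \<Rightarrow> nat set" where
  "red_pts n = {i\<in>{1..n+1}. odd i}"

definition blue_pts :: "nat \<Rightarrow> nat set" where
  "blue_pts n = {i\<in>{1..n+1}. even i}"

text \<open>Expected cost of the greedy matching with uniformly random tie-breaking,
  starting from unmatched reds R and unmatched blues B (fuel = number of remaining steps).
  At each step a closest red/blue pair is chosen uniformly among all closest pairs.\<close>

fun greedy_cost :: "nat \<Rightarrow> (nat \<Rightarrow> real) \<Rightarrow> nat set \<Rightarrow> nat set \<Rightarrow> real" where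
  "greedy_cost 0 pos R B = 0"
| "greedy_cost (Suc k) pos R B =
    (if R = {} \<or> B = {} then 0 else
      (let d = Min {\<bar>pos r - pos b\<bar> | r b. r \<in> R \<and> b \<in> B};
           T = {(r, b). r \<in> R \<and> b \<in> B \<and> \<bar>pos r - pos b\<bar> = d}
       in (\<Sum>(r, b)\<in>T. d + greedy_cost k pos (R - {r}) (B - {b})) / real (card T)))"

definition D_cost :: "nat \<Rightarrow> (nat \<Rightarrow> real) \<Rightarrow> real" where
  "D_cost n x = greedy_cost n (pt_pos x) (red_pts n) (blue_pts n)"

definition E_cost :: "nat \<Rightarrow> (nat \<Rightarrow> real) \<Rightarrow> real" where
  "E_cost n x = (\<Sum>\<pi>\<in>{\<pi>. \<pi> permutes {1..n}}. D_cost n (\<lambda>i. x (\<pi> i))) / fact n"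

definition odd_parts :: "nat \<Rightarrow> nat multiset set" where
  "odd_parts k = {oo. (\<forall>i\<in>#oo. odd i) \<and> sum_mset oo = k}"

definition P_coef :: "nat multiset \<Rightarrow> real" where
  "P_coef oo = 2 ^ (size oo - 1) /
     (\<Prod>i\<in>{1..sum_mset oo}. real i ^ count oo i * fact (count oo i))"

definition Phi :: "nat \<Rightarrow> nat multiset \<Rightarrow> nat set set set" where
  "Phi n oo = {F. (\<forall>S\<in>F. S \<subseteq> {1..n}) \<and> disjoint F \<and> image_mset card (mset_set F) = oo}"

definition f_avg :: "nat \<Rightarrow> nat multiset \<Rightarrow> (nat \<Rightarrow> real) \<Rightarrow> real" where
  "f_avg n oo x = (\<Sum>F\<in>Phi n oo. Min ((\<lambda>S. \<Sum>i\<in>S. x i) ` F)) / real (card (Phi n oo))"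

end

theory Submission
  imports Defs "HOL-Combinatorics.Multiset_Permutations"
begin

text \<open>
  Add an infinite gap and close the gaps up to a circle. A greedy step at a minimal gap merges it
  with its two neighbours, and in a uniformly random arrangement these are two uniformly random
  other gaps. The remaining arrangement is again uniformly random, so \<open>E\<close> satisfies a recursion in
  which the minimal entry \<open>x j\<close> is merged with two further entries, or removed together with one entry
  when it meets the infinite gap.

  The number of permutations of \<open>k\<close> points whose cycles have the odd lengths \<open>o\<close>, divided by \<open>k!\<close>,
  is \<open>P(o) / 2^(r-1)\<close>. So the right-hand side is a sum over disjoint families of odd sets \<open>S\<close>, each
  set weighted by the number \<open>(|S|-1)!\<close> of its cyclic orders. It satisfies the same recursion: either
  \<open>j\<close> is not covered, or \<open>{j}\<close> is a member and the minimum is \<open>x j\<close>, or the member containing \<open>j\<close>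
  arises from a smaller one by inserting two points next to \<open>j\<close> in its cyclic order.
\<close>

section \<open>Weighted families of disjoint odd sets\<close>

text \<open>The shape of the weights is forced by two requirements. Merging replaces a gap by itself
  and two others, so every gap that ever occurs is a sum of an odd number of original gaps; hence
  the odd sizes. The other requirement is the coefficient of the minimal entry \<open>x j\<close>.
  Whenever \<open>{j}\<close> is a member, the minimum is \<open>x j\<close> whatever the other
  members are, so only the total weight of the families on the remaining \<open>n - 1\<close>
  indices counts, where \<open>n\<close> is the number of gaps. With a factor 2 per member this
  total is \<open>2 * fact (n - 1) / fact (n - k)\<close>; after normalization every even
  \<open>k\<close> contributes \<open>2 * (n - 1)\<close>, and the \<open>n / 2\<close> even values
  of \<open>k\<close> add up to \<open>n * (n - 1)\<close>. On the circle this is the number of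
  ordered pairs of neighbours that the minimal gap can have among \<open>n - 1\<close> finite gaps
  and the infinite one.

  A merged gap is not an entry of the original vector. Therefore both sides are treated for an
  arbitrary finite index set \<open>N\<close> with arbitrary positive values, and the merged gap is
  stored under the index \<open>j\<close>.\<close>

definition odd_families :: "'a set \<Rightarrow> nat \<Rightarrow> 'a set set set" where
  "odd_families N k =
    {F. (\<forall>S\<in>F. S \<subseteq> N \<and> odd (card S)) \<and> disjoint F \<and> (\<Sum>S\<in>F. card S) = k}"

text \<open>The factor 2 per member produces \<open>2 ^ r\<close>, which is halved later to give the
  \<open>2 ^ (r - 1)\<close> of \<open>P_coef\<close>. The empty family has weight 1, an exception
  to the uniform totals below.\<close>

definition cycle_weight :: "'a set set \<Rightarrow> real" where
  "cycle_weight F = (\<Prod>S\<in>F. 2 * fact (card S - 1))"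

lemma odd_families_finite_member:
  assumes "finite N" "F \<in> odd_families N k"
  shows "finite F"
proof -
  have "F \<subseteq> Pow N" using assms(2) by (auto simp: odd_families_def)
  then show ?thesis using assms(1) by (meson finite_Pow_iff finite_subset)
qed

lemma finite_odd_families [simp]: "finite N \<Longrightarrow> finite (odd_families N k)"
proof -
  assume "finite N"
  moreover have "odd_families N k \<subseteq> Pow (Pow N)" by (auto simp: odd_families_def)
  ultimately show ?thesis by (meson finite_Pow_iff finite_subset)
qed

lemma card_Union_odd_family:
  assumes "finite N" "F \<in> odd_families N k"
  shows "card (\<Union>F) = k" "\<Union>F \<subseteq> N" "k \<le> card N"
proof -
  have "\<And>S. S \<in> F \<Longrightarrow> finite S"
    using assms by (auto simp: odd_families_def intro: finite_subset)
  then show 1: "card (\<Union>F) = k"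
    using assms(2) by (subst card_Union_disjoint) (auto simp: odd_families_def disjoint_def pairwise_def disjnt_def)
  show 2: "\<Union>F \<subseteq> N" using assms(2) by (auto simp: odd_families_def)
  show "k \<le> card N" using 1 2 card_mono[OF assms(1), of "\<Union>F"] by simp
qed

lemma odd_families_empty: "finite N \<Longrightarrow> card N < k \<Longrightarrow> odd_families N k = {}"
  using card_Union_odd_family(3) by fastforce

lemma odd_families_0: "finite N \<Longrightarrow> odd_families N 0 = {{}}"
proof -
  assume N: "finite N"
  have "F = {}" if "F \<in> odd_families N 0" for F
  proof -
    have "finite F" using odd_families_finite_member[OF N that] .
    then have "\<forall>S\<in>F. card S = 0" using that by (auto simp: odd_families_def)
    then show ?thesis using that by (auto simp: odd_families_def)
  qed
  moreover have "{} \<in> odd_families N 0" by (auto simp: odd_families_def)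
  ultimately show ?thesis by auto
qed

lemma odd_families_insert:
  assumes "finite N" "S \<subseteq> N" "odd (card S)" "card S \<le> k" "F \<in> odd_families (N - S) (k - card S)"
  shows "insert S F \<in> odd_families N k" "S \<notin> F"
proof -
  have fF: "finite F" using assms odd_families_finite_member[of "N - S"] by blast
  have ne: "S \<noteq> {}" using assms(3) by auto
  show n: "S \<notin> F" using assms ne by (auto simp: odd_families_def)
  show "insert S F \<in> odd_families N k"
    using assms n fF by (auto simp: odd_families_def disjoint_def)
qed

lemma odd_families_remove:
  assumes "finite N" "F \<in> odd_families N k" "S \<in> F"
  shows "F - {S} \<in> odd_families (N - S) (k - card S)" "S \<subseteq> N" "odd (card S)" "card S \<le> k"
proof -
  have fF: "finite F" using assms odd_families_finite_member by blast
  have s: "k = card S + (\<Sum>T\<in>F - {S}. card T)"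
    using assms fF sum.remove[of F S card] by (auto simp: odd_families_def)
  moreover have "T \<subseteq> N - S \<and> odd (card T)" if "T \<in> F - {S}" for T
    using that assms(2,3) disjointD[of F T S] by (auto simp: odd_families_def)
  moreover have "disjoint (F - {S})" using assms(2) by (auto simp: odd_families_def disjoint_def)
  ultimately show "F - {S} \<in> odd_families (N - S) (k - card S)"
    unfolding odd_families_def by simp
  show "S \<subseteq> N" "odd (card S)" "card S \<le> k" using assms(2,3) s by (auto simp: odd_families_def)
qed

lemma sum_odd_families_split:
  fixes h :: "'a set set \<Rightarrow> real"
  assumes "finite N" "j \<in> N"
  shows "(\<Sum>F\<in>odd_families N k. h F) = (\<Sum>F\<in>odd_families (N - {j}) k. h F) +
    (\<Sum>S\<in>{S. S \<subseteq> N \<and> j \<in> S \<and> odd (card S) \<and> card S \<le> k}.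
       \<Sum>F\<in>odd_families (N - S) (k - card S). h (insert S F))"
proof -
  let ?A = "{F \<in> odd_families N k. j \<notin> \<Union>F}" and ?B = "{F \<in> odd_families N k. j \<in> \<Union>F}"
  let ?I = "{S. S \<subseteq> N \<and> j \<in> S \<and> odd (card S) \<and> card S \<le> k}"
  let ?P = "Sigma ?I (\<lambda>S. odd_families (N - S) (k - card S))"
  \<comment> \<open>Disjointness leaves at most one member through \<open>j\<close>, so the
    description picks exactly that member on \<open>?B\<close>.\<close>
  let ?T = "\<lambda>F. THE S. S \<in> F \<and> j \<in> S"
  have T: "?T F = S" if "F \<in> odd_families N k" "S \<in> F" "j \<in> S" for F S
  proof (rule the_equality)
    fix S' assume "S' \<in> F \<and> j \<in> S'"
    then show "S' = S" using that disjointD[of F S' S] by (auto simp: odd_families_def)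
  qed (use that in simp)
  have fI: "finite ?I" using assms by (auto intro: finite_subset[of _ "Pow N"])
  have A: "?A = odd_families (N - {j}) k" by (auto simp: odd_families_def)
  have "sum h (odd_families N k) = sum h ?A + sum h ?B"
    using assms by (subst sum.union_disjoint[symmetric]) (auto intro!: sum.cong)
  also have "sum h ?B = (\<Sum>(S,F)\<in>?P. h (insert S F))"
  proof (rule sum.reindex_bij_witness[where i = "\<lambda>(S,F). insert S F" and j = "\<lambda>F. (?T F, F - {?T F})"])
    fix F assume F: "F \<in> ?B"
    then obtain S where S: "S \<in> F" "j \<in> S" by auto
    then have TS: "?T F = S" using T F by blast
    show "(case (?T F, F - {?T F}) of (S,F) \<Rightarrow> insert S F) = F" using TS S by auto
    show "(?T F, F - {?T F}) \<in> ?P"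
      using odd_families_remove[OF assms(1), of F k S] F S unfolding TS by auto
    show "(case (?T F, F - {?T F}) of (S,F) \<Rightarrow> h (insert S F)) = h F" using TS S by (auto simp: insert_absorb)
  next
    fix z assume z: "z \<in> ?P"
    obtain S F where zz: "z = (S,F)" by (cases z)
    have I: "insert S F \<in> odd_families N k" "S \<notin> F"
      using odd_families_insert[OF assms(1), of S k F] z zz by auto
    have TS: "?T (insert S F) = S" using T[OF I(1), of S] z zz by auto
    show "(?T (case z of (S,F) \<Rightarrow> insert S F), (case z of (S,F) \<Rightarrow> insert S F) - {?T (case z of (S,F) \<Rightarrow> insert S F)}) = z"
      unfolding zz prod.case TS using I by auto
    show "(case z of (S,F) \<Rightarrow> insert S F) \<in> ?B" unfolding zz using I z zz by auto
  qed
  also have "\<dots> = (\<Sum>S\<in>?I. \<Sum>F\<in>odd_families (N - S) (k - card S). h (insert S F))"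
    using assms(1) fI by (subst sum.Sigma) auto
  finally show ?thesis unfolding A .
qed

lemma cycle_weight_insert:
  "finite F \<Longrightarrow> S \<notin> F \<Longrightarrow> cycle_weight (insert S F) = 2 * fact (card S - 1) * cycle_weight F"
  by (simp add: cycle_weight_def)

section \<open>Total weight of the families covering k points\<close>

lemma sum_subsets_by_card:
  fixes g :: "nat \<Rightarrow> real"
  assumes "finite N" "j \<in> N"
  shows "(\<Sum>S\<in>{S. S \<subseteq> N \<and> j \<in> S \<and> odd (card S) \<and> card S \<le> k}. g (card S)) =
    (\<Sum>s\<in>{s. odd s \<and> s \<le> k}. real ((card N - 1) choose (s - 1)) * g s)"
proof -
  let ?I = "{S. S \<subseteq> N \<and> j \<in> S \<and> odd (card S) \<and> card S \<le> k}"
  have fI: "finite ?I" using assms by (auto intro: finite_subset[of _ "Pow N"])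
  have c: "card {S. S \<subseteq> N \<and> j \<in> S \<and> card S = s} = (card N - 1) choose (s - 1)" if "odd s" for s
  proof -
    have "{S. S \<subseteq> N \<and> j \<in> S \<and> card S = s} = insert j ` {T. T \<subseteq> N - {j} \<and> card T = s - 1}" (is "?L = ?R")
    proof (intro equalityI subsetI)
      fix S assume S: "S \<in> ?L"
      then have "finite S" using assms finite_subset by blast
      then show "S \<in> ?R" using S by (intro image_eqI[of _ _ "S - {j}"]) auto
    next
      fix S assume "S \<in> ?R"
      then obtain T where T: "S = insert j T" "T \<subseteq> N - {j}" "card T = s - 1" by auto
      moreover have "finite T" using T assms finite_subset by blast
      moreover have "j \<notin> T" using T by auto
      ultimately show "S \<in> ?L" using assms that by (auto simp: odd_pos)
    qed
    moreover have "inj_on (insert j) {T. T \<subseteq> N - {j} \<and> card T = s - 1}"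
      by (auto intro!: inj_onI) 
    ultimately show ?thesis
      using assms n_subsets[of "N - {j}" "s - 1"] by (simp add: card_image)
  qed
  have "(\<Sum>S\<in>?I. g (card S)) = (\<Sum>s\<in>{s. odd s \<and> s \<le> k}. \<Sum>S\<in>{S\<in>?I. card S = s}. g (card S))"
    using fI by (intro sum.group[symmetric]) auto
  also have "\<dots> = (\<Sum>s\<in>{s. odd s \<and> s \<le> k}. real ((card N - 1) choose (s - 1)) * g s)"
  proof (rule sum.cong)
    fix s assume s: "s \<in> {s. odd s \<and> s \<le> k}"
    then have "{S\<in>?I. card S = s} = {S. S \<subseteq> N \<and> j \<in> S \<and> card S = s}" by auto
    then show "(\<Sum>S\<in>{S\<in>?I. card S = s}. g (card S)) = real ((card N - 1) choose (s - 1)) * g s"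
      using c s by auto
  qed simp
  finally show ?thesis .
qed

text \<open>For even \<open>k\<close> there are \<open>k / 2\<close> odd sizes, all counted twice;
  for odd \<open>k\<close> there are \<open>(k + 1) / 2\<close>, the largest counted once. Both give
  \<open>k\<close>. The exceptional size \<open>s = k\<close> is a member through \<open>j\<close>
  that already covers all \<open>k\<close> points.\<close>

lemma sum_over_odd:
  fixes d :: real
  shows "(\<Sum>s\<in>{s. odd s \<and> s \<le> k}. if s = k then d else 2 * d) = real k * d"
proof (induction k rule: induct_nat_012)
  case (ge2 k)
  have "{s. odd s \<and> s \<le> Suc (Suc k)} =
     (if odd k then insert (Suc (Suc k)) {s. odd s \<and> s \<le> k} else insert (Suc k) {s. odd s \<and> s \<le> k})"
    by (auto simp: le_Suc_eq)
  \<comment> \<open>Passing from \<open>k\<close> to \<open>k + 2\<close> makes an odd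
    \<open>s = k\<close> an ordinary size, which now counts twice.\<close>
  moreover have "(\<Sum>s\<in>{s. odd s \<and> s \<le> k}. if s = Suc (Suc k) then d else 2 * d) =
     (\<Sum>s\<in>{s. odd s \<and> s \<le> k}. if s = k then d else 2 * d) + (if odd k then d else 0)"
  proof (cases "odd k")
    case True
    then have "{s. odd s \<and> s \<le> k} = insert k {s. odd s \<and> s < k}" by auto
    then show ?thesis using True by (simp add: sum.insert)
  next
    case False
    then have "s \<noteq> k" "s \<noteq> Suc (Suc k)" if "s \<in> {s. odd s \<and> s \<le> k}" for s using that by auto
    then show ?thesis using False by (auto intro!: sum.cong)
  qed
  ultimately show ?case using ge2 by (auto simp: algebra_simps)
next
  case 1
  have "{s. odd s \<and> s \<le> Suc 0} = {1}" by (auto simp: le_Suc_eq)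
  then show ?case by simp
next
  case 0
  have "{s. odd s \<and> s \<le> (0::nat)} = {}" by (auto elim: oddE)
  then show ?case by (simp only: sum.empty)
qed

text \<open>Generating function behind the count: \<open>exp (2 (z + z^3/3 + z^5/5 + \<dots>)) = (1 + z) / (1 - z)\<close>.\<close>

lemma sum_cycle_weight:
  assumes "finite N" "0 < k" "k \<le> card N"
  shows "(\<Sum>F\<in>odd_families N k. cycle_weight F) = 2 * fact (card N) / fact (card N - k)"
  using assms
proof (induction "card N" arbitrary: N k rule: less_induct)
  case less
  let ?n = "card N"
  obtain j where j: "j \<in> N" using less by fastforce
  let ?Q = "\<lambda>N k. \<Sum>F\<in>odd_families N k. cycle_weight F"
  let ?I = "{S. S \<subseteq> N \<and> j \<in> S \<and> odd (card S) \<and> card S \<le> k}"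
  let ?D = "fact (?n - 1) / fact (?n - k) :: real"
  have cj: "card (N - {j}) = ?n - 1" "?n > 0" "?n - 1 < ?n" using less j by auto
  have fn: "fact ?n = (real ?n * fact (?n - 1) :: real)" using cj(2) by (metis fact_reduce)
  \<comment> \<open>For \<open>k = ?n\<close> no family avoids \<open>j\<close>, and the factor
    \<open>?n - k\<close> vanishes as well.\<close>
  have 1: "?Q (N - {j}) k = 2 * real (?n - k) * ?D"
  proof (cases "k = ?n")
    case True
    then show ?thesis using less cj odd_families_empty[of "N - {j}" k] by auto
  next
    case False
    then have "k \<le> card (N - {j})" using less cj by auto
    then have "?Q (N - {j}) k = 2 * fact (?n - 1) / fact (?n - 1 - k)"
      using less.hyps[of "N - {j}" k] less.prems cj by auto
    moreover have "fact (?n - k) = (real (?n - k) * fact (?n - 1 - k) :: real)"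
      using False less.prems by (metis diff_commute fact_reduce le_neq_implies_less zero_less_diff)
    moreover have "real (?n - k) > 0" using False less.prems by auto
    ultimately show ?thesis by (simp add: field_simps del: of_nat_diff)
  qed
  have 2: "(\<Sum>F\<in>odd_families (N - S) (k - card S). cycle_weight (insert S F)) =
     (\<lambda>s. 2 * fact (s - 1) * (if s = k then 1 else 2 * fact (?n - s) / fact (?n - k))) (card S)" if "S \<in> ?I" for S
  proof -
    have fS: "finite S" using that less.prems finite_subset by blast
    have cS: "card (N - S) = ?n - card S" using that fS less.prems by (simp add: card_Diff_subset)
    have "(\<Sum>F\<in>odd_families (N - S) (k - card S). cycle_weight (insert S F)) =
       (\<Sum>F\<in>odd_families (N - S) (k - card S). 2 * fact (card S - 1) * cycle_weight F)"
    proof (rule sum.cong)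
      fix F assume F: "F \<in> odd_families (N - S) (k - card S)"
      have "S \<notin> F" using odd_families_insert(2)[OF less.prems(1), of S k F] that F by auto
      moreover have "finite F" using F less.prems odd_families_finite_member by blast
      ultimately show "cycle_weight (insert S F) = 2 * fact (card S - 1) * cycle_weight F"
        by (rule cycle_weight_insert[rotated])
    qed simp
    also have "\<dots> = 2 * fact (card S - 1) * ?Q (N - S) (k - card S)"
      by (simp add: sum_distrib_left)
    \<comment> \<open>If no points remain to be covered, only the empty family is left and its
      weight is 1, not the 2 of the general formula.\<close>
    also have "?Q (N - S) (k - card S) = (if card S = k then 1 else 2 * fact (?n - card S) / fact (?n - k))"
    proof (cases "card S = k")
      case True
      then show ?thesis using less.prems odd_families_0[of "N - S"] by (auto simp: cycle_weight_def)
    next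
      case False
      have "card (N - S) < ?n" using that cS cj(2) by (auto simp: odd_pos)
      moreover have "?n - card S - (k - card S) = ?n - k" using that less.prems by auto
      ultimately show ?thesis
        using False that less.hyps[of "N - S" "k - card S"] less.prems cS by auto
    qed
    finally show ?thesis by simp
  qed
  have "?Q N k = ?Q (N - {j}) k +
    (\<Sum>S\<in>?I. (\<lambda>s. 2 * fact (s - 1) * (if s = k then 1 else 2 * fact (?n - s) / fact (?n - k))) (card S))"
    using sum_odd_families_split[OF less.prems(1) j, of cycle_weight k] 2 by simp
  also have "\<dots> = 2 * real (?n - k) * ?D + (\<Sum>s\<in>{s. odd s \<and> s \<le> k}. real ((?n - 1) choose (s - 1)) *
     (2 * fact (s - 1) * (if s = k then 1 else 2 * fact (?n - s) / fact (?n - k))))"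
    unfolding 1 by (subst sum_subsets_by_card[OF less.prems(1) j]) simp
  \<comment> \<open>The number of members of size \<open>s\<close> through \<open>j\<close>, times
    \<open>fact (s - 1)\<close>, is \<open>fact (?n - 1) / fact (?n - s)\<close>. This cancels
    against the total for the rest, so all sizes below \<open>k\<close> contribute equally.\<close>
  also have "(\<Sum>s\<in>{s. odd s \<and> s \<le> k}. real ((?n - 1) choose (s - 1)) *
     (2 * fact (s - 1) * (if s = k then 1 else 2 * fact (?n - s) / fact (?n - k)))) =
     (\<Sum>s\<in>{s. odd s \<and> s \<le> k}. if s = k then 2 * ?D else 2 * (2 * ?D))"
  proof (rule sum.cong)
    fix s assume s: "s \<in> {s. odd s \<and> s \<le> k}"
    then have "s - 1 \<le> ?n - 1" "0 < s" using less.prems by (auto simp: odd_pos)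
    then have "real ((?n - 1) choose (s - 1)) * fact (s - 1) = fact (?n - 1) / fact (?n - s)"
      by (subst binomial_fact) auto
    then show "real ((?n - 1) choose (s - 1)) *
     (2 * fact (s - 1) * (if s = k then 1 else 2 * fact (?n - s) / fact (?n - k))) =
       (if s = k then 2 * ?D else 2 * (2 * ?D))"
      by (auto simp: field_simps)
  qed simp
  also have "\<dots> = real k * (2 * ?D)" by (rule sum_over_odd)
  also have "2 * real (?n - k) * ?D + real k * (2 * ?D) = 2 * real ?n * ?D"
    using less.prems by (simp add: algebra_simps of_nat_diff)
  also have "\<dots> = 2 * fact ?n / fact (?n - k)" by (simp add: fn)
  finally show ?case .
qed

section \<open>Weighted sums of minima and their splitting at an index\<close>

definition family_value :: "'a set \<Rightarrow> nat \<Rightarrow> ('a \<Rightarrow> real) \<Rightarrow> real" where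
  "family_value N k x =
    (\<Sum>F\<in>odd_families N k. cycle_weight F / 2 * Min ((\<lambda>S. \<Sum>i\<in>S. x i) ` F))"

text \<open>This is what is left when a member with sum \<open>c\<close> is split off:
  \<open>c\<close> still competes in the minimum, and the factor 2 of that member has cancelled the
  half in \<open>family_value\<close>. On a finite \<open>N\<close>, \<open>k = 0\<close> leaves
  only the empty family and the value \<open>c\<close>.\<close>

definition capped_value :: "'a set \<Rightarrow> nat \<Rightarrow> real \<Rightarrow> ('a \<Rightarrow> real) \<Rightarrow> real" where
  "capped_value N k c x =
    (\<Sum>F\<in>odd_families N k. cycle_weight F * Min (insert c ((\<lambda>S. \<Sum>i\<in>S. x i) ` F)))"

text \<open>The factor is the reciprocal of \<open>(card N choose k) * fact k\<close>: an average
  over the covered \<open>k\<close>-set and over its permutations, where those with an even cycle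
  count as zero.\<close>

definition odd_expectation :: "'a set \<Rightarrow> ('a \<Rightarrow> real) \<Rightarrow> real" where
  "odd_expectation N x =
    (\<Sum>k\<in>{k. even k \<and> 2 \<le> k \<and> k \<le> card N}. fact (card N - k) / fact (card N) * family_value N k x)"

lemma family_value_cong:
  assumes "\<And>i. i \<in> N \<Longrightarrow> x i = y i"
  shows "family_value N k x = family_value N k y"
proof -
  have "(\<lambda>S. \<Sum>i\<in>S. x i) ` F = (\<lambda>S. \<Sum>i\<in>S. y i) ` F" if "F \<in> odd_families N k" for F
    using that assms by (intro image_cong sum.cong) (auto simp: odd_families_def)
  then show ?thesis unfolding family_value_def by (intro sum.cong) auto
qed

lemma capped_value_cong:
  assumes "\<And>i. i \<in> N \<Longrightarrow> x i = y i"
  shows "capped_value N k c x = capped_value N k c y"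
proof -
  have "(\<lambda>S. \<Sum>i\<in>S. x i) ` F = (\<lambda>S. \<Sum>i\<in>S. y i) ` F" if "F \<in> odd_families N k" for F
    using that assms by (intro image_cong sum.cong) (auto simp: odd_families_def)
  then show ?thesis unfolding capped_value_def by (intro sum.cong) auto
qed

lemma family_value_empty: "finite N \<Longrightarrow> card N < k \<Longrightarrow> family_value N k x = 0"
  by (simp add: family_value_def odd_families_empty)

lemma family_value_split:
  assumes "finite N" "j \<in> N"
  shows "family_value N k x = family_value (N - {j}) k x +
    (\<Sum>S\<in>{S. S \<subseteq> N \<and> j \<in> S \<and> odd (card S) \<and> card S \<le> k}.
       fact (card S - 1) * capped_value (N - S) (k - card S) (\<Sum>i\<in>S. x i) x)"
  unfolding family_value_def sum_odd_families_split[OF assms]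
proof (intro arg_cong2[where f = plus] refl sum.cong)
  fix S assume S: "S \<in> {S. S \<subseteq> N \<and> j \<in> S \<and> odd (card S) \<and> card S \<le> k}"
  show "(\<Sum>F\<in>odd_families (N - S) (k - card S).
       cycle_weight (insert S F) / 2 * Min ((\<lambda>S. \<Sum>i\<in>S. x i) ` insert S F)) =
     fact (card S - 1) * capped_value (N - S) (k - card S) (\<Sum>i\<in>S. x i) x"
    unfolding capped_value_def sum_distrib_left
  proof (rule sum.cong)
    fix F assume F: "F \<in> odd_families (N - S) (k - card S)"
    have "S \<notin> F" using odd_families_insert(2)[OF assms(1), of S k F] S F by auto
    moreover have "finite F" using F assms odd_families_finite_member by blast
    ultimately show "cycle_weight (insert S F) / 2 * Min ((\<lambda>S. \<Sum>i\<in>S. x i) ` insert S F) =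
       fact (card S - 1) * (cycle_weight F * Min (insert (\<Sum>i\<in>S. x i) ((\<lambda>S. \<Sum>i\<in>S. x i) ` F)))"
      by (simp add: cycle_weight_insert)
  qed simp
qed

text \<open>Members are nonempty with nonnegative entries, so each sum dominates one of its entries
  and hence \<open>c\<close>. Every minimum equals \<open>c\<close>, and only the total weight
  remains.\<close>

lemma capped_value_least:
  assumes "finite N" "0 < k" "k \<le> card N" "\<And>i. i \<in> N \<Longrightarrow> 0 \<le> x i" "\<And>i. i \<in> N \<Longrightarrow> c \<le> x i"
  shows "capped_value N k c x = 2 * fact (card N) / fact (card N - k) * c"
proof -
  have "Min (insert c ((\<lambda>S. \<Sum>i\<in>S. x i) ` F)) = c" if F: "F \<in> odd_families N k" for F
  proof (rule Min_eqI)
    show "finite (insert c ((\<lambda>S. \<Sum>i\<in>S. x i) ` F))" using F assms odd_families_finite_member by blast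
    fix y assume "y \<in> insert c ((\<lambda>S. \<Sum>i\<in>S. x i) ` F)"
    moreover have "c \<le> (\<Sum>i\<in>S. x i)" if "S \<in> F" for S
    proof -
      have S: "S \<subseteq> N" "odd (card S)" using that F by (auto simp: odd_families_def)
      then obtain i where i: "i \<in> S" by fastforce
      have "x i \<le> (\<Sum>i\<in>S. x i)"
        using i S assms finite_subset by (intro member_le_sum) auto
      then show ?thesis using i S assms(5)[of i] by auto
    qed
    ultimately show "c \<le> y" by auto
  qed simp
  then have "capped_value N k c x = (\<Sum>F\<in>odd_families N k. cycle_weight F * c)"
    unfolding capped_value_def by (intro sum.cong) auto
  also have "\<dots> = (\<Sum>F\<in>odd_families N k. cycle_weight F) * c" by (simp add: sum_distrib_right)
  finally show ?thesis using sum_cycle_weight[OF assms(1-3)] by simp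
qed

text \<open>The terms in which the minimal index is a singleton of the family contribute a multiple
  of the minimum; in all other terms it can be merged with two further indices.\<close>

lemma family_value_split_least:
  assumes "finite N" "j \<in> N" "even k" "2 \<le> k" "k \<le> card N"
    "\<And>i. i \<in> N \<Longrightarrow> 0 \<le> x i" "\<And>i. i \<in> N \<Longrightarrow> x j \<le> x i"
  shows "family_value N k x = family_value (N - {j}) k x +
    2 * fact (card N - 1) / fact (card N - k) * x j +
    (\<Sum>S\<in>{S. S \<subseteq> N \<and> j \<in> S \<and> odd (card S) \<and> 3 \<le> card S \<and> card S \<le> k}.
       fact (card S - 1) * capped_value (N - S) (k - card S) (\<Sum>i\<in>S. x i) x)"
proof -
  let ?I = "{S. S \<subseteq> N \<and> j \<in> S \<and> odd (card S) \<and> card S \<le> k}"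
  let ?J = "{S. S \<subseteq> N \<and> j \<in> S \<and> odd (card S) \<and> 3 \<le> card S \<and> card S \<le> k}"
  let ?g = "\<lambda>S. fact (card S - 1) * capped_value (N - S) (k - card S) (\<Sum>i\<in>S. x i) x"
  have fJ: "finite ?J" using assms by (auto intro: finite_subset[of _ "Pow N"])
  have "S = {j} \<or> 3 \<le> card S" if "S \<in> ?I" for S
  proof -
    have "card S \<noteq> 2" using that by auto
    moreover have "card S \<noteq> 0" using that by (cases "card S") auto
    moreover have "card S = 1 \<Longrightarrow> S = {j}" using that by (auto simp: card_1_singleton_iff)
    ultimately show ?thesis by linarith
  qed
  then have "?I = insert {j} ?J" using assms by auto
  then have "sum ?g ?I = ?g {j} + sum ?g ?J" using fJ by (simp add: sum.insert)
  moreover have "?g {j} = 2 * fact (card N - 1) / fact (card N - k) * x j"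
    using assms capped_value_least[of "N - {j}" "k - 1" x "x j"] by auto
  ultimately show ?thesis using family_value_split[OF assms(1,2)] by simp
qed

section \<open>Averaging over deleted and merged indices\<close>

text \<open>Double counting: a family covering \<open>k\<close> points is avoided by the other
  \<open>card Y - k\<close> points. For \<open>k > card Y\<close> there are no families, so the
  negative factor does no harm.\<close>

lemma sum_avoid_one:
  fixes h :: "'a set set \<Rightarrow> real"
  assumes "finite Y"
  shows "(\<Sum>a\<in>Y. \<Sum>F\<in>odd_families (Y - {a}) k. h F) = (real (card Y) - real k) * (\<Sum>F\<in>odd_families Y k. h F)"
proof -
  have "(\<Sum>a\<in>Y. \<Sum>F\<in>odd_families (Y - {a}) k. h F) = (\<Sum>a\<in>Y. \<Sum>F\<in>odd_families Y k. if a \<in> \<Union>F then 0 else h F)"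
  proof (rule sum.cong)
    fix a
    have "odd_families (Y - {a}) k = {F\<in>odd_families Y k. \<not> a \<in> \<Union>F}"
      by (auto simp: odd_families_def)
    then show "(\<Sum>F\<in>odd_families (Y - {a}) k. h F) = (\<Sum>F\<in>odd_families Y k. if a \<in> \<Union>F then 0 else h F)"
      using assms by (auto simp: sum.If_cases intro!: sum.cong)
  qed simp
  also have "\<dots> = (\<Sum>F\<in>odd_families Y k. \<Sum>a\<in>Y. if a \<in> \<Union>F then 0 else h F)" by (rule sum.swap)
  also have "\<dots> = (\<Sum>F\<in>odd_families Y k. (real (card Y) - real k) * h F)"
  proof (rule sum.cong)
    fix F assume F: "F \<in> odd_families Y k"
    have "card (Y \<inter> - \<Union>F) = card Y - k" 
      using card_Union_odd_family[OF assms F] assms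
      by (metis Diff_eq card_Diff_subset finite_subset)
    then show "(\<Sum>a\<in>Y. if a \<in> \<Union>F then 0 else h F) = (real (card Y) - real k) * h F"
      using assms card_Union_odd_family(3)[OF assms F] by (simp add: sum.If_cases of_nat_diff Collect_neg_eq del: Union_iff)
  qed simp
  finally show ?thesis by (simp add: sum_distrib_left)
qed

lemma family_value_avoid_one:
  assumes "finite Y"
  shows "(\<Sum>a\<in>Y. family_value (Y - {a}) k x) = (real (card Y) - real k) * family_value Y k x"
  unfolding family_value_def by (rule sum_avoid_one[OF assms])

lemma family_value_avoid_two:
  assumes "finite Y"
  shows "(\<Sum>a\<in>Y. \<Sum>b\<in>Y - {a}. family_value (Y - {a,b}) k x) =
    (real (card Y) - 1 - real k) * (real (card Y) - real k) * family_value Y k x"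
proof -
  have "(\<Sum>b\<in>Y - {a}. family_value (Y - {a,b}) k x) =
     (real (card Y) - 1 - real k) * family_value (Y - {a}) k x" if "a \<in> Y" for a
  proof -
    have "card Y > 0" using that assms by (auto simp: card_gt_0_iff)
    then have "real (card (Y - {a})) = real (card Y) - 1" using that assms by (simp add: of_nat_diff)
    moreover have "Y - {a,b} = Y - {a} - {b}" for b by auto
    ultimately show ?thesis using family_value_avoid_one[of "Y - {a}" k x] assms by simp
  qed
  then show ?thesis
    using family_value_avoid_one[OF assms, of k x] by (simp add: sum_distrib_left[symmetric])
qed

text \<open>A set of size \<open>s\<close> through \<open>j\<close> is reached from
  \<open>(s - 1) * (s - 2)\<close> ordered pairs \<open>(a, b)\<close>, each leaving a set of weight
  \<open>fact (s - 3)\<close>; the product is \<open>fact (s - 1)\<close>. In terms of cyclic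
  orders, \<open>a\<close> and \<open>b\<close> become the two neighbours of
  \<open>j\<close>.\<close>

lemma sum_insert_pair:
  fixes g :: "'a set \<Rightarrow> real"
  assumes "finite N" "j \<in> N"
  shows "(\<Sum>a\<in>N - {j}. \<Sum>b\<in>N - {j} - {a}.
      \<Sum>S\<in>{S. S \<subseteq> N - {a,b} \<and> j \<in> S \<and> odd (card S) \<and> card S \<le> k}. fact (card S - 1) * g (S \<union> {a,b})) =
    (\<Sum>S\<in>{S. S \<subseteq> N \<and> j \<in> S \<and> odd (card S) \<and> 3 \<le> card S \<and> card S \<le> k + 2}. fact (card S - 1) * g S)"
proof -
  let ?I = "\<lambda>a b. {S. S \<subseteq> N - {a,b} \<and> j \<in> S \<and> odd (card S) \<and> card S \<le> k}"
  let ?J = "{S. S \<subseteq> N \<and> j \<in> S \<and> odd (card S) \<and> 3 \<le> card S \<and> card S \<le> k + 2}"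
  let ?A = "Sigma (N - {j}) (\<lambda>a. Sigma (N - {j} - {a}) (\<lambda>b. ?I a b))"
  let ?B = "Sigma ?J (\<lambda>S. Sigma (S - {j}) (\<lambda>a. S - {j} - {a}))"
  have fI: "finite (?I a b)" "finite ?J" for a b using assms by (auto intro: finite_subset[of _ "Pow N"])
  have fS: "finite S" if "S \<subseteq> N" for S using that assms finite_subset by blast
  have "(\<Sum>a\<in>N - {j}. \<Sum>b\<in>N - {j} - {a}. \<Sum>S\<in>?I a b. fact (card S - 1) * g (S \<union> {a,b})) =
     (\<Sum>(a,b,S)\<in>?A. fact (card S - 1) * g (S \<union> {a,b}))"
    using assms fI by (simp add: sum.Sigma split_def)
  also have "\<dots> = (\<Sum>(S,a,b)\<in>?B. fact (card S - 3) * g S)"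
  proof (rule sum.reindex_bij_witness[where i = "\<lambda>(S,a,b). (a,b,S - {a,b})" and j = "\<lambda>(a,b,S). (S \<union> {a,b},a,b)"])
    fix z assume z: "z \<in> ?A"
    obtain a b S where zz: "z = (a,b,S)" by (cases z) auto
    have S: "S \<subseteq> N" "a \<notin> S" "b \<notin> S" "a \<noteq> b" "a \<in> N" "b \<in> N" "j \<in> S" "odd (card S)" "card S \<le> k" "a \<noteq> j" "b \<noteq> j"
      using z zz by auto
    have c: "card (S \<union> {a,b}) = card S + 2" using S fS[of S] by simp
    have c1: "1 \<le> card S" using S(8) by (cases "card S") auto
    show "(case (case z of (a,b,S) \<Rightarrow> (S \<union> {a,b},a,b)) of (S,a,b) \<Rightarrow> (a,b,S - {a,b})) = z"
      using zz S by auto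
    show "(case z of (a,b,S) \<Rightarrow> (S \<union> {a,b},a,b)) \<in> ?B"
      unfolding zz prod.case using S c c1 by (simp del: Un_insert_right)
    show "(case (case z of (a,b,S) \<Rightarrow> (S \<union> {a,b},a,b)) of (S,a,b) \<Rightarrow> fact (card S - 3) * g S) =
       (case z of (a,b,S) \<Rightarrow> fact (card S - 1) * g (S \<union> {a,b}))"
      unfolding zz prod.case using c c1 by (simp del: Un_insert_right)
  next
    fix z assume z: "z \<in> ?B"
    obtain a b S where zz: "z = (S,a,b)" by (cases z) auto
    have S: "S \<subseteq> N" "a \<in> S" "b \<in> S" "a \<noteq> b" "j \<in> S" "odd (card S)" "3 \<le> card S" "card S \<le> k + 2" "a \<noteq> j" "b \<noteq> j"
      using z zz by auto
    have c: "card (S - {a,b}) = card S - 2" using S fS[of S] by (subst card_Diff_subset) auto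
    show "(case (case z of (S,a,b) \<Rightarrow> (a,b,S - {a,b})) of (a,b,S) \<Rightarrow> (S \<union> {a,b},a,b)) = z"
      using zz S by auto
    show "(case z of (S,a,b) \<Rightarrow> (a,b,S - {a,b})) \<in> ?A"
      unfolding zz prod.case using S c by auto
  qed
  also have "\<dots> = (\<Sum>S\<in>?J. \<Sum>a\<in>S - {j}. \<Sum>b\<in>S - {j} - {a}. fact (card S - 3) * g S)"
  proof -
    have "(\<Sum>(S,a,b)\<in>?B. fact (card S - 3) * g S) =
       (\<Sum>S\<in>?J. \<Sum>(a,b)\<in>Sigma (S - {j}) (\<lambda>a. S - {j} - {a}). fact (card S - 3) * g S)"
      using fI(2) fS by (subst sum.Sigma) auto
    also have "\<dots> = (\<Sum>S\<in>?J. \<Sum>a\<in>S - {j}. \<Sum>b\<in>S - {j} - {a}. fact (card S - 3) * g S)"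
      using fS by (intro sum.cong refl, subst sum.Sigma) auto
    finally show ?thesis .
  qed
  also have "\<dots> = (\<Sum>S\<in>?J. fact (card S - 1) * g S)"
  proof (rule sum.cong)
    fix S assume S: "S \<in> ?J"
    have c: "card (S - {j} - {a}) = card S - 2" if "a \<in> S - {j}" for a
      using S that fS[of S] by auto
    obtain t where t: "card S = t + 3" using S by (metis (lifting) le_add_diff_inverse2 mem_Collect_eq)
    have "(\<Sum>a\<in>S - {j}. \<Sum>b\<in>S - {j} - {a}. fact (card S - 3) * g S) =
       (\<Sum>a\<in>S - {j}. real (card S - 2) * (fact (card S - 3) * g S))"
      using c by (intro sum.cong) auto
    also have "\<dots> = real (card S - 1) * (real (card S - 2) * (fact (card S - 3) * g S))"
      using S fS[of S] by simp
    also have "\<dots> = fact (card S - 1) * g S"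
      unfolding t by (simp add: numeral_3_eq_3 algebra_simps)
    finally show "(\<Sum>a\<in>S - {j}. \<Sum>b\<in>S - {j} - {a}. fact (card S - 3) * g S) = fact (card S - 1) * g S" .
  qed simp
  finally show ?thesis .
qed

text \<open>A family avoiding \<open>j\<close> does not see the merged value and is counted once for
  each ordered pair of points of \<open>Y\<close> outside it. Otherwise the member through
  \<open>j\<close> has, with its merged value, the same sum as that member enlarged by
  \<open>a\<close> and \<open>b\<close> has under \<open>x\<close>.\<close>

lemma family_value_merge:
  fixes x :: "'a \<Rightarrow> real"
  assumes "finite N" "j \<in> N"
  defines "Y \<equiv> N - {j}"
  shows "(\<Sum>a\<in>Y. \<Sum>b\<in>Y - {a}. family_value (N - {a,b}) k (x(j := x j + x a + x b))) =
    (real (card N) - 2 - real k) * (real (card N) - 1 - real k) * family_value Y k x +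
    (\<Sum>S\<in>{S. S \<subseteq> N \<and> j \<in> S \<and> odd (card S) \<and> 3 \<le> card S \<and> card S \<le> k + 2}.
       fact (card S - 1) * capped_value (N - S) (k + 2 - card S) (\<Sum>i\<in>S. x i) x)"
proof -
  let ?g = "\<lambda>S. capped_value (N - S) (k + 2 - card S) (\<Sum>i\<in>S. x i) x"
  let ?I = "\<lambda>a b. {S. S \<subseteq> N - {a,b} \<and> j \<in> S \<and> odd (card S) \<and> card S \<le> k}"
  have fY: "finite Y" using assms(1) by (simp add: Y_def)
  have cY: "real (card Y) = real (card N) - 1" 
  proof -
    have "card N = Suc (card Y)" unfolding Y_def using assms(1,2) by (rule card.remove)
    then show ?thesis by simp
  qed
  have *: "family_value (N - {a,b}) k (x(j := x j + x a + x b)) = family_value (Y - {a,b}) k x +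
     (\<Sum>S\<in>?I a b. fact (card S - 1) * ?g (S \<union> {a,b}))"
    if ab: "a \<in> Y" "b \<in> Y - {a}" for a b
  proof -
    let ?x = "x(j := x j + x a + x b)"
    have 1: "family_value (N - {a,b} - {j}) k ?x = family_value (Y - {a,b}) k x"
    proof -
      have "N - {a,b} - {j} = Y - {a,b}" by (auto simp: Y_def)
      then show ?thesis by (simp only:) (rule family_value_cong, auto simp: Y_def)
    qed
    have 2: "capped_value (N - {a,b} - S) (k - card S) (\<Sum>i\<in>S. ?x i) ?x = ?g (S \<union> {a,b})"
      if S: "S \<in> ?I a b" for S
    proof -
      have fS: "finite S" using S assms(1) finite_subset by blast
      have nin: "a \<notin> S" "b \<notin> S" "a \<noteq> b" using S ab by auto
      then have "card (S \<union> {a,b}) = card S + 2" using fS by simp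
      moreover have "(\<Sum>i\<in>S. ?x i) = (\<Sum>i\<in>S \<union> {a,b}. x i)"
      proof -
        have "(\<Sum>i\<in>S. ?x i) = ?x j + (\<Sum>i\<in>S - {j}. ?x i)" using S fS by (intro sum.remove) auto
        also have "(\<Sum>i\<in>S - {j}. ?x i) = (\<Sum>i\<in>S - {j}. x i)" by (intro sum.cong) auto
        also have "?x j + (\<Sum>i\<in>S - {j}. x i) = x a + x b + (\<Sum>i\<in>S. x i)"
          using S fS sum.remove[of S j x] by auto
        also have "\<dots> = (\<Sum>i\<in>S \<union> {a,b}. x i)" using fS nin by simp
        finally show ?thesis .
      qed
      moreover have "N - {a,b} - S = N - (S \<union> {a,b})" by auto
      moreover have "capped_value (N - (S \<union> {a,b})) q c ?x = capped_value (N - (S \<union> {a,b})) q c x" for q c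
        using S by (intro capped_value_cong) auto
      ultimately show ?thesis by simp
    qed
    have "j \<in> N - {a,b}" using assms(2) ab by (auto simp: Y_def)
    then show ?thesis
      using family_value_split[of "N - {a,b}" j k ?x] assms(1) 1 2 by simp
  qed
  have "(\<Sum>a\<in>Y. \<Sum>b\<in>Y - {a}. family_value (N - {a,b}) k (x(j := x j + x a + x b))) =
     (\<Sum>a\<in>Y. \<Sum>b\<in>Y - {a}. family_value (Y - {a,b}) k x) +
     (\<Sum>a\<in>Y. \<Sum>b\<in>Y - {a}. \<Sum>S\<in>?I a b. fact (card S - 1) * ?g (S \<union> {a,b}))"
    using * by (simp add: sum.distrib)
  then show ?thesis
    using family_value_avoid_two[OF fY, of k x] sum_insert_pair[OF assms(1,2), of ?g k]
    unfolding Y_def[symmetric] cY by (simp add: algebra_simps)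
qed

section \<open>The recursion for the right-hand side\<close>

lemma card_even_upto:
  assumes "even n"
  shows "2 * card {k. even k \<and> 2 \<le> k \<and> k \<le> n} = n"
proof -
  have "{k. even k \<and> 2 \<le> k \<and> k \<le> n} = (\<lambda>i. 2 * i) ` {1..n div 2}"
    using assms by (auto elim!: evenE)
  then show ?thesis using assms by (simp add: card_image inj_on_def)
qed

text \<open>The factor 2 stands for the infinite gap on either side of \<open>j\<close>. The two
  sides are compared separately on families avoiding \<open>j\<close> (\<open>?A\<close>), on those
  with \<open>{j}\<close> as a member, and on those with a larger member through \<open>j\<close>
  (\<open>?B\<close>).\<close>

lemma odd_expectation_rec:
  fixes x :: "'a \<Rightarrow> real"
  assumes "finite N" "j \<in> N" "even (card N)"
    "\<And>i. i \<in> N \<Longrightarrow> 0 \<le> x i" "\<And>i. i \<in> N \<Longrightarrow> x j \<le> x i"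
  defines "Y \<equiv> N - {j}"
  shows "real (card N) * (real (card N) - 1) * odd_expectation N x =
    real (card N) * (real (card N) - 1) * x j +
    2 * (\<Sum>a\<in>Y. odd_expectation (N - {j,a}) x) +
    (\<Sum>a\<in>Y. \<Sum>b\<in>Y - {a}. odd_expectation (N - {a,b}) (x(j := x j + x a + x b)))"
proof -
  define n where "n = card N"
  have fY: "finite Y" using assms(1) by (simp add: Y_def)
  have n0: "n \<noteq> 0" using assms(1,2) by (auto simp: n_def)
  have n2: "n \<ge> 2" "even n" using n0 assms(3) by (auto simp: n_def elim!: evenE)
  have cY: "card Y = n - 1" using assms(1,2) by (simp add: Y_def n_def)
  have f: "fact n = real n * (real n - 1) * (fact (n - 2) :: real)"
  proof -
    obtain t where t: "n = t + 2" using n2 by (metis le_add_diff_inverse2)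
    show ?thesis unfolding t by (simp add: algebra_simps)
  qed
  let ?K = "\<lambda>n::nat. {k. even k \<and> 2 \<le> k \<and> k \<le> n}"
  let ?A = "\<lambda>k. family_value Y k x"
  let ?B = "\<lambda>k. \<Sum>S\<in>{S. S \<subseteq> N \<and> j \<in> S \<and> odd (card S) \<and> 3 \<le> card S \<and> card S \<le> k}.
       fact (card S - 1) * capped_value (N - S) (k - card S) (\<Sum>i\<in>S. x i) x"
  let ?c = "\<lambda>k. fact (n - k) / fact (n - 2) :: real"
  have fK: "finite (?K k)" for k by simp
  have K: "?K n = insert n (?K (n - 2))"
    using n2 by (auto simp: elim!: evenE)
  \<comment> \<open>At \<open>k = n\<close> the set \<open>Y\<close> has too few points, so the
    additional term is zero.\<close>
  have sumA: "(\<Sum>k\<in>?K (n - 2). ?c k * ?A k) = (\<Sum>k\<in>?K n. ?c k * ?A k)"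
    unfolding K using n2 fK family_value_empty[OF fY, of n x] by (subst sum.insert) (auto simp: cY)
  have B2: "?B 2 = 0" by (intro sum.neutral) auto
  \<comment> \<open>A member through \<open>j\<close> gains two points when the merge is undone,
    which shifts \<open>k\<close> by 2. The index 2 outside the shifted range contributes nothing to
    \<open>?B\<close>.\<close>
  have K': "?K n = insert 2 ((\<lambda>k. k + 2) ` ?K (n - 2))"
  proof (intro equalityI subsetI)
    fix k assume k: "k \<in> ?K n"
    show "k \<in> insert 2 ((\<lambda>k. k + 2) ` ?K (n - 2))"
    proof (cases "k = 2")
      case False
      then have "k \<noteq> 3" "k > 2" using k by auto
      then show ?thesis using k by (intro insertI2 image_eqI[of _ _ "k - 2"]) auto
    qed simp
  qed (use n2 in auto)
  have sumB: "(\<Sum>k\<in>?K (n - 2). fact (n - 2 - k) / fact (n - 2) * ?B (k + 2)) = (\<Sum>k\<in>?K n. ?c k * ?B k)"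
  proof -
    have "(\<Sum>k\<in>?K n. ?c k * ?B k) = (\<Sum>k\<in>(\<lambda>k. k + 2) ` ?K (n - 2). ?c k * ?B k)"
      unfolding K' using fK B2 by (subst sum.insert) auto
    also have "\<dots> = (\<Sum>k\<in>?K (n - 2). ?c (k + 2) * ?B (k + 2))"
      by (subst sum.reindex) (auto simp: o_def inj_on_def)
    finally show ?thesis by (simp add: diff_diff_eq add.commute)
  qed
  have rhs1: "(\<Sum>a\<in>Y. odd_expectation (N - {j,a}) x) =
    (\<Sum>k\<in>?K (n - 2). fact (n - 2 - k) / fact (n - 2) * ((real n - 1 - real k) * ?A k))"
  proof -
    have "(\<Sum>a\<in>Y. odd_expectation (N - {j,a}) x) =
      (\<Sum>a\<in>Y. \<Sum>k\<in>?K (n - 2). fact (n - 2 - k) / fact (n - 2) * family_value (Y - {a}) k x)"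
    proof (rule sum.cong)
      fix a assume "a \<in> Y"
      then have "card (Y - {a}) = n - 2" "N - {j,a} = Y - {a}" using fY cY by (auto simp: Y_def)
      then show "odd_expectation (N - {j,a}) x =
        (\<Sum>k\<in>?K (n - 2). fact (n - 2 - k) / fact (n - 2) * family_value (Y - {a}) k x)"
        by (simp add: odd_expectation_def)
    qed simp
    also have "\<dots> = (\<Sum>k\<in>?K (n - 2). fact (n - 2 - k) / fact (n - 2) * (\<Sum>a\<in>Y. family_value (Y - {a}) k x))"
      by (subst sum.swap) (simp add: sum_distrib_left)
    finally show ?thesis using n0 by (simp add: family_value_avoid_one[OF fY] cY of_nat_diff)
  qed
  have rhs2: "(\<Sum>a\<in>Y. \<Sum>b\<in>Y - {a}. odd_expectation (N - {a,b}) (x(j := x j + x a + x b))) =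
    (\<Sum>k\<in>?K (n - 2). fact (n - 2 - k) / fact (n - 2) *
      ((real n - 2 - real k) * (real n - 1 - real k) * ?A k + ?B (k + 2)))"
  proof -
    have "(\<Sum>a\<in>Y. \<Sum>b\<in>Y - {a}. odd_expectation (N - {a,b}) (x(j := x j + x a + x b))) =
      (\<Sum>a\<in>Y. \<Sum>b\<in>Y - {a}. \<Sum>k\<in>?K (n - 2). fact (n - 2 - k) / fact (n - 2) *
         family_value (N - {a,b}) k (x(j := x j + x a + x b)))"
    proof (intro sum.cong refl)
      fix a b assume "a \<in> Y" "b \<in> Y - {a}"
      then have "card (N - {a,b}) = n - 2" using assms(1) by (subst card_Diff_subset) (auto simp: Y_def n_def)
      then show "odd_expectation (N - {a,b}) (x(j := x j + x a + x b)) =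
        (\<Sum>k\<in>?K (n - 2). fact (n - 2 - k) / fact (n - 2) *
         family_value (N - {a,b}) k (x(j := x j + x a + x b)))"
        by (simp add: odd_expectation_def)
    qed
    also have "\<dots> = (\<Sum>a\<in>Y. \<Sum>k\<in>?K (n - 2). \<Sum>b\<in>Y - {a}. fact (n - 2 - k) / fact (n - 2) *
         family_value (N - {a,b}) k (x(j := x j + x a + x b)))"
      by (intro sum.cong refl sum.swap)
    also have "\<dots> = (\<Sum>k\<in>?K (n - 2). \<Sum>a\<in>Y. \<Sum>b\<in>Y - {a}. fact (n - 2 - k) / fact (n - 2) *
         family_value (N - {a,b}) k (x(j := x j + x a + x b)))"
      by (rule sum.swap)
    also have "\<dots> = (\<Sum>k\<in>?K (n - 2). fact (n - 2 - k) / fact (n - 2) *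
      (\<Sum>a\<in>Y. \<Sum>b\<in>Y - {a}. family_value (N - {a,b}) k (x(j := x j + x a + x b))))"
      by (simp only: sum_distrib_left)
    finally show ?thesis
      unfolding Y_def family_value_merge[OF assms(1,2)] unfolding n_def .
  qed
  have "2 * (\<Sum>a\<in>Y. odd_expectation (N - {j,a}) x) +
    (\<Sum>a\<in>Y. \<Sum>b\<in>Y - {a}. odd_expectation (N - {a,b}) (x(j := x j + x a + x b))) =
    (\<Sum>k\<in>?K (n - 2). ?c k * ?A k + fact (n - 2 - k) / fact (n - 2) * ?B (k + 2))"
    unfolding rhs1 rhs2 sum_distrib_left[where A = "?K (n - 2)"] sum.distrib[symmetric]
  proof (rule sum.cong)
    fix k assume k: "k \<in> ?K (n - 2)"
    obtain t where t: "n = t + 2 + k" using k n2 by (metis (lifting) le_add_diff_inverse2 mem_Collect_eq add.assoc add.commute)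
    \<comment> \<open>A family avoiding \<open>j\<close> survives if both neighbours of
      \<open>j\<close> lie outside it: \<open>2 * (n - 1 - k)\<close> ordered pairs with the
      infinite gap and \<open>(n - 1 - k) * (n - 2 - k)\<close> without it, together
      \<open>(n - k) * (n - 1 - k)\<close>.\<close>
    have e: "fact (n - k) = (real n - k) * (real n - 1 - k) * (fact (n - 2 - k) :: real)"
      unfolding t by (simp add: algebra_simps)
    show "2 * (fact (n - 2 - k) / fact (n - 2) * ((real n - 1 - real k) * ?A k)) +
      fact (n - 2 - k) / fact (n - 2) * ((real n - 2 - real k) * (real n - 1 - real k) * ?A k + ?B (k + 2)) =
      ?c k * ?A k + fact (n - 2 - k) / fact (n - 2) * ?B (k + 2)"
      unfolding e by (simp add: field_simps)
  qed simp
  also have "\<dots> = (\<Sum>k\<in>?K n. ?c k * ?A k) + (\<Sum>k\<in>?K n. ?c k * ?B k)"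
    by (simp only: sum.distrib sumA sumB)
  finally have R: "2 * (\<Sum>a\<in>Y. odd_expectation (N - {j,a}) x) +
    (\<Sum>a\<in>Y. \<Sum>b\<in>Y - {a}. odd_expectation (N - {a,b}) (x(j := x j + x a + x b))) =
    (\<Sum>k\<in>?K n. ?c k * ?A k) + (\<Sum>k\<in>?K n. ?c k * ?B k)" .
  have "real n * (real n - 1) * odd_expectation N x =
     (\<Sum>k\<in>?K n. real n * (real n - 1) * (fact (n - k) / fact n * family_value N k x))"
    by (simp add: odd_expectation_def n_def sum_distrib_left)
  also have "\<dots> = (\<Sum>k\<in>?K n. ?c k * ?A k + 2 * (real n - 1) * x j + ?c k * ?B k)"
  proof (rule sum.cong)
    fix k assume k: "k \<in> ?K n"
    have c: "real n * (real n - 1) * (fact (n - k) / fact n) = ?c k"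
      unfolding f using n2 by simp
    have g: "fact (n - 1) = (real n - 1) * (fact (n - 2) :: real)"
    proof -
      obtain t where t: "n = t + 2" using n2 by (metis le_add_diff_inverse2)
      show ?thesis unfolding t by (simp add: algebra_simps)
    qed
    have "family_value N k x = ?A k + 2 * fact (n - 1) / fact (n - k) * x j + ?B k"
      unfolding Y_def n_def
      by (rule family_value_split_least) (use k assms in \<open>auto simp: n_def\<close>)
    then have "real n * (real n - 1) * (fact (n - k) / fact n * family_value N k x) =
       ?c k * (?A k + 2 * fact (n - 1) / fact (n - k) * x j + ?B k)"
      by (simp only: c[symmetric] mult.assoc)
    also have "\<dots> = ?c k * ?A k + 2 * (real n - 1) * x j + ?c k * ?B k"
      unfolding g by (simp add: distrib_left)
    finally show "real n * (real n - 1) * (fact (n - k) / fact n * family_value N k x) =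
       ?c k * ?A k + 2 * (real n - 1) * x j + ?c k * ?B k" .
  qed simp
  also have "\<dots> = (\<Sum>k\<in>?K n. ?c k * ?A k) + (\<Sum>k\<in>?K n. ?c k * ?B k) + real n * (real n - 1) * x j"
  proof -
    have eq: "real (card (?K n)) * 2 = real n"
      using arg_cong[OF card_even_upto[OF n2(2)], of real] by (simp only: of_nat_mult mult.commute of_nat_numeral)
    have "real (card (?K n)) * (2 * (real n - 1) * x j) = real (card (?K n)) * 2 * (real n - 1) * x j"
      by (simp only: mult.assoc)
    then have "real (card (?K n)) * (2 * (real n - 1) * x j) = real n * (real n - 1) * x j"
      unfolding eq .
    then show ?thesis by (simp only: sum.distrib sum_constant)
  qed
  finally show ?thesis using R unfolding n_def by simp
qed

section \<open>The greedy matching as a process on gaps\<close>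

text \<open>Matching the two endpoints of gap \<open>i\<close>: an interior gap merges with both of its neighbours,
  while an outer gap disappears together with its only neighbour.\<close>

definition merge_gap :: "nat \<Rightarrow> real list \<Rightarrow> real list" where
  "merge_gap i gs =
    (if i = 0 then drop 2 gs
     else if Suc i = length gs then take (i - 1) gs
     else take (i - 1) gs @ [gs ! (i - 1) + gs ! i + gs ! (i + 1)] @ drop (i + 2) gs)"

definition min_positions :: "real list \<Rightarrow> nat set" where
  "min_positions gs = {i. i < length gs \<and> gs ! i = Min (set gs)}"

text \<open>The fuel is the exact number of pairs still to be matched: fuel \<open>k\<close> goes
  with a list of \<open>2 * k\<close> gaps.\<close>

fun gap_cost :: "nat \<Rightarrow> real list \<Rightarrow> real" where
  "gap_cost 0 gs = 0"
| "gap_cost (Suc k) gs =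
    (\<Sum>i\<in>min_positions gs. Min (set gs) + gap_cost k (merge_gap i gs)) / real (card (min_positions gs))"

section \<open>From point configurations to gap lists\<close>

definition gaps :: "(nat \<Rightarrow> real) \<Rightarrow> nat list \<Rightarrow> real list" where
  "gaps pos ps = map (\<lambda>i. pos (ps ! Suc i) - pos (ps ! i)) [0..<length ps - 1]"

lemma length_gaps [simp]: "length (gaps pos ps) = length ps - 1"
  by (simp add: gaps_def)

lemma nth_gaps [simp]: "i < length ps - 1 \<Longrightarrow> gaps pos ps ! i = pos (ps ! Suc i) - pos (ps ! i)"
  by (simp add: gaps_def)

lemma nth_take_drop_two:
  "Suc i < length ps \<Longrightarrow> j < length ps - 2 \<Longrightarrow>
    (take i ps @ drop (i + 2) ps) ! j = (if j < i then ps ! j else ps ! (j + 2))"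
  by (auto simp: nth_append min_def)

text \<open>The new gap between the points at positions \<open>i - 1\<close> and
  \<open>i + 2\<close> telescopes into three old ones; at either end of the list there is no such
  gap.\<close>

lemma gaps_take_drop_two:
  assumes "Suc i < length ps"
  shows "gaps pos (take i ps @ drop (i + 2) ps) = merge_gap i (gaps pos ps)"
proof (rule nth_equalityI)
  show "length (gaps pos (take i ps @ drop (i + 2) ps)) = length (merge_gap i (gaps pos ps))"
    using assms by (auto simp: merge_gap_def)
  fix j assume "j < length (gaps pos (take i ps @ drop (i + 2) ps))"
  then have j: "Suc j < length ps - 2" using assms by auto
  have l: "gaps pos (take i ps @ drop (i + 2) ps) ! j =
    pos (if Suc j < i then ps ! Suc j else ps ! (Suc j + 2)) - pos (if j < i then ps ! j else ps ! (j + 2))"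
  proof -
    have j': "j < length ps - 2" using j by simp
    have "length (take i ps @ drop (i + 2) ps) = length ps - 2" using assms by auto
    then have "gaps pos (take i ps @ drop (i + 2) ps) ! j =
      pos ((take i ps @ drop (i + 2) ps) ! Suc j) - pos ((take i ps @ drop (i + 2) ps) ! j)"
      using j by (intro nth_gaps) simp
    then show ?thesis by (simp only: nth_take_drop_two[OF assms j] nth_take_drop_two[OF assms j'])
  qed
  have r: "merge_gap i (gaps pos ps) ! j =
    (if Suc j < i then gaps pos ps ! j
     else if Suc j = i then gaps pos ps ! j + gaps pos ps ! Suc j + gaps pos ps ! (j + 2)
     else gaps pos ps ! (j + 2))"
    using j assms by (auto simp: merge_gap_def nth_append min_def)
  show "gaps pos (take i ps @ drop (i + 2) ps) ! j = merge_gap i (gaps pos ps) ! j"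
    unfolding l r using j assms by auto
qed

text \<open>Later positions shift by two, which keeps their parity; so the colours still alternate
  after a match.\<close>

lemma parity_take_drop_two:
  assumes "Suc i < length ps"
  shows "{(take i ps @ drop (i + 2) ps) ! j | j. j < length ps - 2 \<and> (even j = c)} =
    {ps ! l | l. l < length ps \<and> (even l = c) \<and> l \<noteq> i \<and> l \<noteq> Suc i}" (is "?L = ?R")
proof (intro equalityI subsetI)
  fix p assume "p \<in> ?L"
  then obtain j where j: "j < length ps - 2" "even j = c" "p = (take i ps @ drop (i + 2) ps) ! j" by blast
  show "p \<in> ?R"
  proof (cases "j < i")
    case True
    then show ?thesis using j assms nth_take_drop_two[OF assms j(1)] by auto
  next
    case False
    then have "p = ps ! (j + 2)" using j nth_take_drop_two[OF assms j(1)] by simp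
    then show ?thesis using j False by (intro CollectI exI[of _ "j + 2"]) auto
  qed
next
  fix p assume "p \<in> ?R"
  then obtain l where l: "l < length ps" "even l = c" "l \<noteq> i" "l \<noteq> Suc i" "p = ps ! l" by blast
  show "p \<in> ?L"
  proof (cases "l < i")
    case True
    then have "l < length ps - 2" using assms by auto
    then show ?thesis using l True nth_take_drop_two[OF assms, of l]
      by (intro CollectI exI[of _ l]) auto
  next
    case False
    then have "2 \<le> l" using l by auto
    then obtain t where t: "l = t + 2" by (metis le_add_diff_inverse2)
    have t': "t < length ps - 2" "\<not> t < i" using l False t by auto
    then have "p = (take i ps @ drop (i + 2) ps) ! t"
      using l t nth_take_drop_two[OF assms t'(1)] by simp
    then show ?thesis using l(2) t t' by (intro CollectI exI[of _ t]) auto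
  qed
qed

text \<open>The invariant is that the remaining points alternate in colour, with red at the even
  positions. A closest red/blue pair must then be adjacent, and every adjacent pair has opposite
  colours, so closest pairs are the minimal gaps. The fuel \<open>K\<close> may exceed
  \<open>k\<close>, since \<open>greedy_cost\<close> stops by itself when no blue point is
  left.\<close>

lemma greedy_cost_eq_gap_cost:
  assumes "length ps = 2 * k + 1" "k \<le> K" "sorted_wrt (\<lambda>a b. pos a < pos b) ps"
    "R = {ps ! i | i. i < length ps \<and> even i}" "B = {ps ! i | i. i < length ps \<and> odd i}"
  shows "greedy_cost K pos R B = gap_cost k (gaps pos ps)"
  using assms
proof (induction k arbitrary: K ps R B)
  case 0
  then have "B = {}" by auto
  then show ?case by (cases K) auto
next
  case (Suc k)
  obtain K' where K: "K = Suc K'" "k \<le> K'" using Suc.prems by (cases K) auto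
  let ?gs = "gaps pos ps" and ?n = "length ps"
  let ?G = "Min (set ?gs)"
  note R = Suc.prems(4) and B = Suc.prems(5)
  have n: "?n = 2 * k + 3" using Suc.prems by simp
  have lt: "pos (ps ! i) < pos (ps ! l)" if "i < l" "l < ?n" for i l
    using Suc.prems(3) that by (simp add: sorted_wrt_iff_nth_less)
  have dist: "i = l" if "ps ! i = ps ! l" "i < ?n" "l < ?n" for i l
    using lt[of i l] lt[of l i] that by (metis less_irrefl nat_neq_iff)
  have G_le: "?G \<le> pos (ps ! Suc i) - pos (ps ! i)" if "Suc i < ?n" for i
  proof -
    have "?gs ! i \<in> set ?gs" using that by (intro nth_mem) simp
    then show ?thesis using that by (simp add: Min_le)
  qed
  \<comment> \<open>Positions increase strictly, so a pair that is not adjacent is strictly farther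
    apart than the first gap it spans.\<close>
  have gap: "?G \<le> pos (ps ! l) - pos (ps ! i) \<and> (?G = pos (ps ! l) - pos (ps ! i) \<longrightarrow> l = Suc i)"
    if "i < l" "l < ?n" for i l
  proof (cases "l = Suc i")
    case False
    then have "Suc i < l" using that by simp
    then show ?thesis using lt[of "Suc i" l] G_le[of i] that by fastforce
  qed (use G_le that in auto)
  have remove: "{ps ! l | l. l < ?n \<and> Q l} - {ps ! e} = {ps ! l | l. (l < ?n \<and> Q l) \<and> l \<noteq> e}"
    if "e < ?n" for e Q
    using dist that by blast
  have "?G \<in> set ?gs" using n by (intro Min_in) (auto simp: gaps_def)
  then obtain i0 where i0: "i0 < ?n - 1" "?gs ! i0 = ?G" by (metis in_set_conv_nth length_gaps)
  \<comment> \<open>The endpoints of gap \<open>i\<close>, red one first; the parity of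
    \<open>i\<close> tells which endpoint is red.\<close>
  define pr where "pr i = (if even i then (ps ! i, ps ! Suc i) else (ps ! Suc i, ps ! i))" for i
  have prRB: "fst (pr i) \<in> R \<and> snd (pr i) \<in> B" if "Suc i < ?n" for i
    using that unfolding pr_def R B by (cases "even i") auto
  have prd: "\<bar>pos (fst (pr i)) - pos (snd (pr i))\<bar> = ?gs ! i" if "Suc i < ?n" for i
    using that lt[of i "Suc i"] by (auto simp: pr_def)
  have RB: "?G \<le> \<bar>pos r - pos b\<bar> \<and> (\<bar>pos r - pos b\<bar> = ?G \<longrightarrow> (\<exists>i\<in>min_positions ?gs. (r, b) = pr i))"
    if r: "r \<in> R" and b: "b \<in> B" for r b
  proof -
    obtain i l where i: "r = ps ! i" "i < ?n" "even i" and l: "b = ps ! l" "l < ?n" "odd l"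
      using r b unfolding R B by blast
    have "i \<noteq> l" using i l by auto
    then consider "i < l" | "l < i" by linarith
    then show ?thesis
    proof cases
      case 1
      have *: "\<bar>pos r - pos b\<bar> = pos (ps ! l) - pos (ps ! i)" using lt[OF 1 l(2)] i l by simp
      have "i \<in> min_positions ?gs \<and> (r, b) = pr i" if "\<bar>pos r - pos b\<bar> = ?G"
        using gap[OF 1 l(2)] that * i l by (auto simp: min_positions_def pr_def)
      then show ?thesis using gap[OF 1 l(2)] * by auto
    next
      case 2
      have *: "\<bar>pos r - pos b\<bar> = pos (ps ! i) - pos (ps ! l)" using lt[OF 2 i(2)] i l by simp
      have "l \<in> min_positions ?gs \<and> (r, b) = pr l" if "\<bar>pos r - pos b\<bar> = ?G"
        using gap[OF 2 i(2)] that * i l by (auto simp: min_positions_def pr_def)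
      then show ?thesis using gap[OF 2 i(2)] * by auto
    qed
  qed
  let ?D = "{\<bar>pos r - pos b\<bar> | r b. r \<in> R \<and> b \<in> B}"
  have "finite R" "finite B" unfolding R B by auto
  then have "finite ((\<lambda>(r,b). \<bar>pos r - pos b\<bar>) ` (R \<times> B))" by auto
  moreover have "?D = (\<lambda>(r,b). \<bar>pos r - pos b\<bar>) ` (R \<times> B)" by auto
  ultimately have fD: "finite ?D" by simp
  have d: "Min ?D = ?G"
  proof (rule Min_eqI)
    show "?G \<in> ?D" using prRB[of i0] prd[of i0] i0 by (smt (verit) CollectI Suc_lessI less_diff_conv Suc_eq_plus1)
  qed (use fD RB in auto)
  have T: "{(r, b). r \<in> R \<and> b \<in> B \<and> \<bar>pos r - pos b\<bar> = ?G} = pr ` min_positions ?gs" (is "?T = _")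
  proof (intro equalityI subsetI)
    fix z assume "z \<in> pr ` min_positions ?gs"
    then obtain i where i: "z = pr i" "Suc i < ?n" "?gs ! i = ?G" by (auto simp: min_positions_def)
    then show "z \<in> ?T" using prRB[of i] prd[of i] by (cases "pr i") auto
  qed (use RB in auto)
  \<comment> \<open>Distinct minimal gaps give distinct closest pairs, so both processes choose
    uniformly among equally many options.\<close>
  have inj: "inj_on pr (min_positions ?gs)"
  proof (rule inj_onI)
    fix i l assume il: "i \<in> min_positions ?gs" "l \<in> min_positions ?gs" "pr i = pr l"
    then have b: "Suc i < ?n" "Suc l < ?n" by (auto simp: min_positions_def)
    show "i = l"
    proof (cases "even i = even l")
      case True
      then show ?thesis using il(3) b dist[of i l] by (auto simp: pr_def split: if_splits)
    next
      case False
      then have "ps ! i = ps ! Suc l" "ps ! Suc i = ps ! l" using il(3) by (auto simp: pr_def split: if_splits)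
      then show ?thesis using dist[of i "Suc l"] dist[of "Suc i" l] b by auto
    qed
  qed
  have step: "greedy_cost K' pos (R - {fst (pr i)}) (B - {snd (pr i)}) = gap_cost k (merge_gap i ?gs)"
    if i: "i \<in> min_positions ?gs" for i
  proof -
    have b: "Suc i < ?n" using i by (auto simp: min_positions_def)
    let ?ps = "take i ps @ drop (i + 2) ps"
    have lp: "length ?ps = ?n - 2" using b by auto
    have "R - {fst (pr i)} = {ps ! l | l. l < ?n \<and> (even l = True) \<and> l \<noteq> i \<and> l \<noteq> Suc i}"
    proof -
      define e where "e = (if even i then i else Suc i)"
      have "fst (pr i) = ps ! e" "e < ?n" using b by (auto simp: pr_def e_def)
      then have "R - {fst (pr i)} = {ps ! l | l. (l < ?n \<and> even l) \<and> l \<noteq> e}"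
        unfolding R using remove by simp
      moreover have "((l < ?n \<and> even l) \<and> l \<noteq> e) = (l < ?n \<and> (even l = True) \<and> l \<noteq> i \<and> l \<noteq> Suc i)" for l
        by (auto simp: e_def)
      ultimately show ?thesis by (simp only:)
    qed
    also have "\<dots> = {?ps ! j | j. j < length ?ps \<and> even j}"
      unfolding lp using parity_take_drop_two[OF b, of True] by simp
    finally have R': "R - {fst (pr i)} = {?ps ! j | j. j < length ?ps \<and> even j}" .
    have "B - {snd (pr i)} = {ps ! l | l. l < ?n \<and> (even l = False) \<and> l \<noteq> i \<and> l \<noteq> Suc i}"
    proof -
      define e where "e = (if odd i then i else Suc i)"
      have "snd (pr i) = ps ! e" "e < ?n" using b by (auto simp: pr_def e_def)
      then have "B - {snd (pr i)} = {ps ! l | l. (l < ?n \<and> odd l) \<and> l \<noteq> e}"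
        unfolding B using remove by simp
      moreover have "((l < ?n \<and> odd l) \<and> l \<noteq> e) = (l < ?n \<and> (even l = False) \<and> l \<noteq> i \<and> l \<noteq> Suc i)" for l
        by (auto simp: e_def)
      ultimately show ?thesis by (simp only:)
    qed
    also have "\<dots> = {?ps ! j | j. j < length ?ps \<and> odd j}"
      unfolding lp using parity_take_drop_two[OF b, of False] by simp
    finally have B': "B - {snd (pr i)} = {?ps ! j | j. j < length ?ps \<and> odd j}" .
    have s: "sorted_wrt (\<lambda>a b. pos a < pos b) ?ps"
      unfolding sorted_wrt_iff_nth_less
    proof (intro allI impI)
      fix u v assume "u < v" "v < length ?ps"
      then have uv: "u < v" "v < ?n - 2" "u < ?n - 2" using lp by auto
      then show "pos (?ps ! u) < pos (?ps ! v)"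
        unfolding nth_take_drop_two[OF b uv(2)] nth_take_drop_two[OF b uv(3)]
        using lt[of u v] lt[of u "v + 2"] lt[of "u + 2" "v + 2"] by auto
    qed
    have "greedy_cost K' pos (R - {fst (pr i)}) (B - {snd (pr i)}) = gap_cost k (gaps pos ?ps)"
      using Suc.IH[OF _ K(2) s R' B'] lp n by simp
    then show ?thesis by (simp only: gaps_take_drop_two[OF b])
  qed
  have "Suc i0 < ?n" using i0(1) by arith
  from prRB[OF this] have ne: "R \<noteq> {}" "B \<noteq> {}" by auto
  have "greedy_cost K pos R B =
    (\<Sum>(r, b)\<in>pr ` min_positions ?gs. ?G + greedy_cost K' pos (R - {r}) (B - {b})) / real (card (pr ` min_positions ?gs))"
    using ne unfolding K(1) greedy_cost.simps Let_def d T by simp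
  also have "\<dots> = gap_cost (Suc k) ?gs"
    by (simp add: sum.reindex[OF inj] card_image[OF inj] split_def step)
  finally show ?case .
qed

lemma D_cost_eq_gap_cost:
  assumes "n = 2 * m" "\<And>i. i \<in> {1..n} \<Longrightarrow> 0 < x i"
  shows "D_cost n x = gap_cost m (map x [1..<n + 1])"
proof -
  have nth: "[1..<n + 2] ! i = i + 1" if "i < n + 1" for i using that by (subst nth_upt) auto
  have pos: "pt_pos x (Suc i) - pt_pos x i = x i" if "1 \<le> i" for i
    using that by (simp add: pt_pos_def sum.atLeastLessThan_Suc)
  have "gaps (pt_pos x) [1..<n + 2] = map x [1..<n + 1]"
    using nth pos by (intro nth_equalityI) (auto simp del: upt_Suc simp: nth_upt)
  moreover have "sorted_wrt (\<lambda>a b. pt_pos x a < pt_pos x b) [1..<n + 2]"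
    unfolding sorted_wrt_iff_nth_less
  proof (intro allI impI)
    fix i j assume ij: "i < j" "j < length [1..<n + 2]"
    then have j: "j \<le> n" by (simp del: upt_Suc)
    have "(\<Sum>j\<in>{1..<i + 1}. x j) < (\<Sum>j\<in>{1..<j + 1}. x j)"
      using ij(1) j assms(2) by (intro sum_strict_mono2[where b = j]) (auto intro!: less_imp_le[OF assms(2)])
    then show "pt_pos x ([1..<n + 2] ! i) < pt_pos x ([1..<n + 2] ! j)"
      using ij nth by (simp add: pt_pos_def del: upt_Suc)
  qed
  \<comment> \<open>Point \<open>i + 1\<close> sits at position \<open>i\<close>, so odd labels
    become even positions.\<close>
  moreover have "red_pts n = {[1..<n + 2] ! i | i. i < length [1..<n + 2] \<and> even i}"
  proof (intro equalityI subsetI)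
    fix p assume "p \<in> red_pts n"
    then show "p \<in> {[1..<n + 2] ! i | i. i < length [1..<n + 2] \<and> even i}"
      using nth[of "p - 1"] by (intro CollectI exI[of _ "p - 1"]) (auto simp: red_pts_def simp del: upt_Suc)
  qed (use nth in \<open>auto simp: red_pts_def simp del: upt_Suc\<close>)
  moreover have "blue_pts n = {[1..<n + 2] ! i | i. i < length [1..<n + 2] \<and> odd i}"
  proof (intro equalityI subsetI)
    fix p assume p: "p \<in> blue_pts n"
    then have "p \<noteq> 0" "odd (p - 1)" by (auto simp: blue_pts_def)
    then show "p \<in> {[1..<n + 2] ! i | i. i < length [1..<n + 2] \<and> odd i}"
      using p nth[of "p - 1"] by (intro CollectI exI[of _ "p - 1"]) (auto simp: blue_pts_def simp del: upt_Suc)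
  qed (use nth in \<open>auto simp: blue_pts_def simp del: upt_Suc\<close>)
  ultimately show ?thesis
    unfolding D_cost_def using greedy_cost_eq_gap_cost[of "[1..<n + 2]" m n "pt_pos x"] assms(1)
    by (simp del: upt_Suc)
qed

section \<open>Averaging over arrangements\<close>

lemma merge_gap_interior:
  "merge_gap (Suc (length us)) (us @ a # c # b # vs) = us @ (a + c + b) # vs"
  by (simp add: merge_gap_def nth_append)

lemma sum_Sigma_quadruples:
  fixes g :: "'a \<Rightarrow> 'b \<Rightarrow> 'c \<Rightarrow> 'd \<Rightarrow> real"
  assumes "finite A" "\<And>a. a \<in> A \<Longrightarrow> finite (B a)" "\<And>a b. a \<in> A \<Longrightarrow> b \<in> B a \<Longrightarrow> finite (C a b)"
    "\<And>a b c. a \<in> A \<Longrightarrow> b \<in> B a \<Longrightarrow> c \<in> C a b \<Longrightarrow> finite (D a b c)"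
  shows "(\<Sum>(a,b,c,d)\<in>Sigma A (\<lambda>a. Sigma (B a) (\<lambda>b. Sigma (C a b) (\<lambda>c. D a b c))). g a b c d) =
    (\<Sum>a\<in>A. \<Sum>b\<in>B a. \<Sum>c\<in>C a b. \<Sum>d\<in>D a b c. g a b c d)"
  using assms by (simp add: sum.Sigma split_def)

text \<open>If \<open>j\<close> stands first or last, it disappears with its neighbour
  \<open>a\<close>; both ends leave the same lists, hence the factor 2. If \<open>j\<close> is
  interior with neighbours \<open>a\<close> and \<open>b\<close>, the merged gap keeps the name
  \<open>j\<close>, and each arrangement of \<open>N - {a,b}\<close> arises exactly once for each
  ordered pair.\<close>

lemma sum_merge_gap:
  fixes x :: "'a \<Rightarrow> real" and \<phi> :: "real list \<Rightarrow> real"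
  assumes "finite N" "j \<in> N" "2 \<le> card N"
  defines "Y \<equiv> N - {j}"
  shows "(\<Sum>p\<in>permutations_of_set N. \<Sum>i\<in>{i. i < card N \<and> p ! i = j}. \<phi> (merge_gap i (map x p))) =
    2 * (\<Sum>a\<in>Y. \<Sum>q\<in>permutations_of_set (N - {j,a}). \<phi> (map x q)) +
    (\<Sum>a\<in>Y. \<Sum>b\<in>Y - {a}. \<Sum>q\<in>permutations_of_set (N - {a,b}). \<phi> (map (x(j := x j + x a + x b)) q))"
proof -
  define n where "n = card N"
  define h where "h = (\<lambda>z. \<phi> (merge_gap (snd z) (map x (fst z))))"
  let ?Z = "Sigma (permutations_of_set N) (\<lambda>p. {i. i < n \<and> p ! i = j})"
  let ?First = "{z \<in> ?Z. snd z = 0}"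
  let ?Last = "{z \<in> ?Z. Suc (snd z) = n}"
  let ?Inner = "{z \<in> ?Z. snd z \<noteq> 0 \<and> Suc (snd z) \<noteq> n}"
  have n2: "2 \<le> n" using assms by (simp add: n_def)
  have fY: "finite Y" using assms(1) by (simp add: Y_def)
  have fZ: "finite ?Z" by (intro finite_SigmaI) auto
  have len: "length p = n" "distinct p" "set p = N" if "p \<in> permutations_of_set N" for p
    using that permutations_of_setD[OF that] by (auto simp: n_def distinct_card)
  have "(\<Sum>p\<in>permutations_of_set N. \<Sum>i\<in>{i. i < n \<and> p ! i = j}. \<phi> (merge_gap i (map x p))) = sum h ?Z"
    by (subst sum.Sigma) (auto simp: h_def split_def)
  also have "\<dots> = sum h (?First \<union> ?Last \<union> ?Inner)" by (intro arg_cong2[where f = sum] refl) auto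
  also have "\<dots> = sum h ?First + sum h ?Last + sum h ?Inner"
  proof -
    have fin: "finite ?First" "finite ?Last" "finite ?Inner" by (rule finite_subset[OF Collect_restrict fZ])+
    have "?First \<inter> ?Last = {}" "(?First \<union> ?Last) \<inter> ?Inner = {}" using n2 by auto
    then show ?thesis using fin by (simp add: sum.union_disjoint)
  qed
  also have "sum h ?First = (\<Sum>(a,q)\<in>Sigma Y (\<lambda>a. permutations_of_set (N - {j,a})). \<phi> (map x q))"
  proof (rule sum.reindex_bij_witness[where i = "\<lambda>(a,q). (j # a # q, 0)" and j = "\<lambda>(p,i). (p ! 1, drop 2 p)"])
    fix z assume z: "z \<in> ?First"
    then obtain p where p: "z = (p, 0)" "p \<in> permutations_of_set N" "p ! 0 = j" by (cases z) auto
    then obtain a q where q: "p = j # a # q" using len(1)[OF p(2)] n2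
      by (cases p; cases "tl p") auto
    then have "set (j # a # q) = N" "distinct (j # a # q)" using len[OF p(2)] by auto
    then show "(case z of (p,i) \<Rightarrow> (p ! 1, drop 2 p)) \<in> Sigma Y (\<lambda>a. permutations_of_set (N - {j,a}))"
      unfolding p q by (auto simp: Y_def permutations_of_set_def)
    show "(case (case z of (p,i) \<Rightarrow> (p ! 1, drop 2 p)) of (a,q) \<Rightarrow> (j # a # q, 0)) = z"
      unfolding p q by simp
    show "(case (case z of (p,i) \<Rightarrow> (p ! 1, drop 2 p)) of (a,q) \<Rightarrow> \<phi> (map x q)) = h z"
      unfolding p q h_def by (simp add: merge_gap_def)
  next
    fix z assume "z \<in> Sigma Y (\<lambda>a. permutations_of_set (N - {j,a}))"
    then obtain a q where z: "z = (a,q)" "a \<in> Y" "q \<in> permutations_of_set (N - {j,a})" by (cases z) auto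
    then have "j # a # q \<in> permutations_of_set N"
      using assms(2) by (auto simp: Y_def permutations_of_set_def)
    then show "(case z of (a,q) \<Rightarrow> (j # a # q, 0)) \<in> ?First" using z n2 by auto
    show "(case (case z of (a,q) \<Rightarrow> (j # a # q, 0)) of (p,i) \<Rightarrow> (p ! 1, drop 2 p)) = z"
      unfolding z by simp
  qed
  also have "sum h ?Last = (\<Sum>(a,q)\<in>Sigma Y (\<lambda>a. permutations_of_set (N - {j,a})). \<phi> (map x q))"
  proof (rule sum.reindex_bij_witness[where i = "\<lambda>(a,q). (q @ [a,j], n - 1)" and j = "\<lambda>(p,i). (p ! (n - 2), take (n - 2) p)"])
    fix z assume z: "z \<in> ?Last"
    then obtain p where p: "z = (p, n - 1)" "p \<in> permutations_of_set N" "p ! (n - 1) = j" by (cases z) auto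
    obtain a q where q: "p = q @ [a,j]"
    proof -
      obtain c r where r: "p = r @ [c]" using len(1)[OF p(2)] n2 by (cases p rule: rev_cases) auto
      moreover obtain d q where "r = q @ [d]" using r len(1)[OF p(2)] n2 by (cases r rule: rev_cases) auto
      moreover have "c = j" using p(3) r len(1)[OF p(2)] by (auto simp: nth_append)
      ultimately show thesis using that by auto
    qed
    then have s: "set (q @ [a,j]) = N" "distinct (q @ [a,j])" using len[OF p(2)] by auto
    have l: "n = Suc (Suc (length q))" using len(1)[OF p(2)] q by simp
    show "(case z of (p,i) \<Rightarrow> (p ! (n - 2), take (n - 2) p)) \<in> Sigma Y (\<lambda>a. permutations_of_set (N - {j,a}))"
      unfolding p q using s l by (auto simp: Y_def permutations_of_set_def)
    show "(case (case z of (p,i) \<Rightarrow> (p ! (n - 2), take (n - 2) p)) of (a,q) \<Rightarrow> (q @ [a,j], n - 1)) = z"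
      unfolding p q by (simp add: l)
    show "(case (case z of (p,i) \<Rightarrow> (p ! (n - 2), take (n - 2) p)) of (a,q) \<Rightarrow> \<phi> (map x q)) = h z"
      unfolding p q h_def by (simp add: l merge_gap_def)
  next
    fix z assume "z \<in> Sigma Y (\<lambda>a. permutations_of_set (N - {j,a}))"
    then obtain a q where z: "z = (a,q)" "a \<in> Y" "q \<in> permutations_of_set (N - {j,a})" by (cases z) auto
    then have p: "q @ [a,j] \<in> permutations_of_set N"
      using assms(2) by (auto simp: Y_def permutations_of_set_def)
    have l: "n = Suc (Suc (length q))" using len(1)[OF p] by simp
    show "(case z of (a,q) \<Rightarrow> (q @ [a,j], n - 1)) \<in> ?Last" using z p l by (simp add: nth_append)
    show "(case (case z of (a,q) \<Rightarrow> (q @ [a,j], n - 1)) of (p,i) \<Rightarrow> (p ! (n - 2), take (n - 2) p)) = z"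
      unfolding z using l by simp
  qed
  \<comment> \<open>The position of \<open>j\<close> in the shortened list is recorded too, because
    the inverse map must know where to reinsert \<open>a\<close> and \<open>b\<close>.\<close>
  also have "sum h ?Inner = (\<Sum>(a,b,q,i)\<in>Sigma Y (\<lambda>a. Sigma (Y - {a}) (\<lambda>b.
      Sigma (permutations_of_set (N - {a,b})) (\<lambda>q. {i. i < length q \<and> q ! i = j}))).
      \<phi> (map (x(j := x j + x a + x b)) q))"
    (is "_ = sum ?g ?W")
  proof (rule sum.reindex_bij_witness[where
        i = "\<lambda>(a,b,q,i). (take i q @ a # j # b # drop (Suc i) q, Suc i)" and
        j = "\<lambda>(p,i). (p ! (i - 1), p ! Suc i, take (i - 1) p @ j # drop (i + 2) p, i - 1)"])
    fix z assume z: "z \<in> ?Inner"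
    then obtain p i where p: "z = (p, Suc i)" "p \<in> permutations_of_set N" "p ! Suc i = j" "i + 2 < n"
      by (cases z; cases "snd z") auto
    define us where "us = take i p"
    define vs where "vs = drop (i + 3) p"
    define a where "a = p ! i"
    define b where "b = p ! (i + 2)"
    have q: "p = us @ a # j # b # vs"
      using p(3,4) len(1)[OF p(2)] unfolding us_def vs_def a_def b_def
      by (simp add: Cons_nth_drop_Suc numeral_3_eq_3 flip: p(3))
    have i: "i = length us" using p(4) len(1)[OF p(2)] by (simp add: us_def)
    have s: "set (us @ a # j # b # vs) = N" "distinct (us @ a # j # b # vs)" using len[OF p(2)] q by auto
    have j: "(case z of (p,i) \<Rightarrow> (p ! (i - 1), p ! Suc i, take (i - 1) p @ j # drop (i + 2) p, i - 1)) =
      (a, b, us @ j # vs, length us)"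
      unfolding p q i by (simp add: nth_append)
    have "us @ j # vs \<in> permutations_of_set (N - {a,b})" "a \<in> Y" "b \<in> Y - {a}"
      using s by (auto simp: Y_def permutations_of_set_def)
    then show "(case z of (p,i) \<Rightarrow> (p ! (i - 1), p ! Suc i, take (i - 1) p @ j # drop (i + 2) p, i - 1)) \<in> ?W"
      unfolding j by simp
    show "(case (case z of (p,i) \<Rightarrow> (p ! (i - 1), p ! Suc i, take (i - 1) p @ j # drop (i + 2) p, i - 1)) of
      (a,b,q,i) \<Rightarrow> (take i q @ a # j # b # drop (Suc i) q, Suc i)) = z"
      unfolding j by (simp add: p(1) q i)
    have "map (x(j := x j + x a + x b)) (us @ j # vs) = map x us @ (x a + x j + x b) # map x vs"
      using s by auto
    also have "\<dots> = merge_gap (Suc i) (map x p)"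
      using merge_gap_interior[of "map x us" "x a" "x j" "x b" "map x vs"] by (simp add: q i)
    finally show "?g (case z of (p,i) \<Rightarrow> (p ! (i - 1), p ! Suc i, take (i - 1) p @ j # drop (i + 2) p, i - 1)) = h z"
      unfolding j by (simp add: h_def p(1))
  next
    fix z assume "z \<in> ?W"
    then obtain a b q i where z: "z = (a,b,q,i)" "a \<in> Y" "b \<in> Y" "a \<noteq> b"
      "q \<in> permutations_of_set (N - {a,b})" "i < length q" "q ! i = j"
      by (cases z) auto
    define us where "us = take i q"
    define vs where "vs = drop (Suc i) q"
    have q: "q = us @ j # vs" unfolding us_def vs_def using id_take_nth_drop[OF z(6)] z(7) by simp
    have i: "i = length us" using z by (simp add: us_def)
    have s: "set (us @ j # vs) = N - {a,b}" "distinct (us @ j # vs)"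
      using permutations_of_setD[OF z(5)] q by auto
    have "us @ a # j # b # vs \<in> permutations_of_set N"
      using s z(2-4) by (auto simp: Y_def permutations_of_set_def)
    moreover from len(1)[OF this] have "n = length us + length vs + 3" by simp
    ultimately show "(case z of (a,b,q,i) \<Rightarrow> (take i q @ a # j # b # drop (Suc i) q, Suc i)) \<in> ?Inner"
      unfolding z(1) q i by (simp add: nth_append)
    show "(case (case z of (a,b,q,i) \<Rightarrow> (take i q @ a # j # b # drop (Suc i) q, Suc i)) of
      (p,i) \<Rightarrow> (p ! (i - 1), p ! Suc i, take (i - 1) p @ j # drop (i + 2) p, i - 1)) = z"
      unfolding z(1) q i by (simp add: nth_append)
  qed
  also have "\<dots> = (\<Sum>a\<in>Y. \<Sum>b\<in>Y - {a}. \<Sum>q\<in>permutations_of_set (N - {a,b}).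
      \<Sum>i\<in>{i. i < length q \<and> q ! i = j}. \<phi> (map (x(j := x j + x a + x b)) q))"
    using fY by (intro sum_Sigma_quadruples) auto
  \<comment> \<open>\<open>j\<close> occurs exactly once in \<open>q\<close>, so the recorded
    position adds no multiplicity.\<close>
  also have "\<dots> = (\<Sum>a\<in>Y. \<Sum>b\<in>Y - {a}. \<Sum>q\<in>permutations_of_set (N - {a,b}). \<phi> (map (x(j := x j + x a + x b)) q))"
  proof (intro sum.cong refl)
    fix a b q assume "a \<in> Y" "b \<in> Y - {a}" "q \<in> permutations_of_set (N - {a,b})"
    then have "j \<in> set q" "distinct q" using assms(2) by (auto simp: Y_def permutations_of_set_def)
    then obtain i where "i < length q" "q ! i = j" by (auto simp: in_set_conv_nth)
    then have "{i. i < length q \<and> q ! i = j} = {i}"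
      using \<open>distinct q\<close> by (auto simp: nth_eq_iff_index_eq)
    then show "(\<Sum>i\<in>{i. i < length q \<and> q ! i = j}. \<phi> (map (x(j := x j + x a + x b)) q)) =
      \<phi> (map (x(j := x j + x a + x b)) q)" by simp
  qed
  finally show ?thesis using fY by (simp add: n_def sum.Sigma split_def)
qed

text \<open>By symmetry of the sum, ties may be broken towards any fixed minimal index.\<close>

lemma sum_gap_cost_permutations:
  fixes x :: "'a \<Rightarrow> real"
  assumes "finite N" "card N = 2 * m" "\<And>i. i \<in> N \<Longrightarrow> 0 < x i"
  shows "(\<Sum>p\<in>permutations_of_set N. gap_cost m (map x p)) = fact (card N) * odd_expectation N x"
  using assms
proof (induction m arbitrary: N x)
  case 0
  have "{k. even k \<and> 2 \<le> k \<and> k \<le> card N} = {}" using 0(2) by auto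
  then have "odd_expectation N x = 0" by (simp only: odd_expectation_def sum.empty)
  then show ?case by simp
next
  case (Suc m)
  define n where "n = card N"
  have n: "n = 2 * m + 2" using Suc.prems by (simp add: n_def)
  have ne: "N \<noteq> {}" using Suc.prems(2) by auto
  let ?G = "Min (x ` N)"
  define M where "M = {j \<in> N. x j = ?G}"
  have "?G \<in> x ` N" using Suc.prems(1) ne by (intro Min_in) auto
  then have M: "M \<noteq> {}" "finite M" using Suc.prems(1) by (auto simp: M_def)
  then have cM: "real (card M) \<noteq> 0" by simp
  have len: "length p = n" "distinct p" "set p = N" if "p \<in> permutations_of_set N" for p
    using that permutations_of_setD[OF that] by (auto simp: n_def distinct_card)
  have min_pos: "min_positions (map x p) = {i. i < n \<and> p ! i \<in> M}" "Min (set (map x p)) = ?G"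
    if p: "p \<in> permutations_of_set N" for p
    using len[OF p] by (auto simp: min_positions_def M_def)
  \<comment> \<open>The denominator of the tie-breaking is \<open>card M\<close> in every
    arrangement, so it can be pulled out of the sum.\<close>
  have card_min_pos: "card {i. i < n \<and> p ! i \<in> M} = card M" if p: "p \<in> permutations_of_set N" for p
  proof (rule bij_betw_same_card)
    have "inj_on (nth p) {i. i < n \<and> p ! i \<in> M}"
      using len[OF p] by (auto intro!: inj_onI simp: nth_eq_iff_index_eq)
    moreover have "nth p ` {i. i < n \<and> p ! i \<in> M} = M"
    proof (intro equalityI subsetI)
      fix j assume j: "j \<in> M"
      then have "j \<in> set p" using len[OF p] by (auto simp: M_def)
      then obtain i where "i < n" "p ! i = j" using len[OF p] by (auto simp: in_set_conv_nth)
      then show "j \<in> nth p ` {i. i < n \<and> p ! i \<in> M}" using j by auto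
    qed auto
    ultimately show "bij_betw (nth p) {i. i < n \<and> p ! i \<in> M} M" by (simp add: bij_betw_def)
  qed
  let ?h = "\<lambda>p i. ?G + gap_cost m (merge_gap i (map x p))"
  have "(\<Sum>p\<in>permutations_of_set N. gap_cost (Suc m) (map x p)) =
    (\<Sum>p\<in>permutations_of_set N. \<Sum>i\<in>{i. i < n \<and> p ! i \<in> M}. ?h p i) / real (card M)"
    unfolding sum_divide_distrib
  proof (rule sum.cong)
    fix p assume p: "p \<in> permutations_of_set N"
    show "gap_cost (Suc m) (map x p) = (\<Sum>i\<in>{i. i < n \<and> p ! i \<in> M}. ?h p i / real (card M))"
      by (simp only: gap_cost.simps min_pos[OF p] card_min_pos[OF p] sum_divide_distrib)
  qed simp
  also have "(\<Sum>p\<in>permutations_of_set N. \<Sum>i\<in>{i. i < n \<and> p ! i \<in> M}. ?h p i) =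
    (\<Sum>p\<in>permutations_of_set N. \<Sum>j\<in>M. \<Sum>i\<in>{i. i < n \<and> p ! i = j}. ?h p i)"
  proof (rule sum.cong)
    fix p assume p: "p \<in> permutations_of_set N"
    have "(\<Sum>i\<in>{i. i < n \<and> p ! i \<in> M}. ?h p i) =
      (\<Sum>j\<in>M. \<Sum>i\<in>{i \<in> {i. i < n \<and> p ! i \<in> M}. p ! i = j}. ?h p i)"
      using M by (intro sum.group[symmetric]) auto
    also have "\<dots> = (\<Sum>j\<in>M. \<Sum>i\<in>{i. i < n \<and> p ! i = j}. ?h p i)"
      by (intro sum.cong) auto
    finally show "(\<Sum>i\<in>{i. i < n \<and> p ! i \<in> M}. ?h p i) =
      (\<Sum>j\<in>M. \<Sum>i\<in>{i. i < n \<and> p ! i = j}. ?h p i)" .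
  qed simp
  also have "\<dots> = (\<Sum>j\<in>M. \<Sum>p\<in>permutations_of_set N. \<Sum>i\<in>{i. i < n \<and> p ! i = j}. ?h p i)"
    by (rule sum.swap)
  \<comment> \<open>The recursion holds at every minimal \<open>j\<close>, so all inner sums agree
    and division by \<open>card M\<close> leaves one copy.\<close>
  also have "\<dots> = (\<Sum>j\<in>M. fact n * odd_expectation N x)"
  proof (rule sum.cong)
    fix j assume "j \<in> M"
    then have j: "j \<in> N" "x j = ?G" by (auto simp: M_def)
    let ?Y = "N - {j}"
    have IH1: "(\<Sum>q\<in>permutations_of_set (N - {j,a}). gap_cost m (map x q)) =
      fact (n - 2) * odd_expectation (N - {j,a}) x" if a: "a \<in> ?Y" for a
    proof -
      have c: "card (N - {j,a}) = n - 2"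
        using a j Suc.prems(1) by (subst card_Diff_subset) (auto simp: n_def)
      then show ?thesis using Suc.IH[of "N - {j,a}" x] Suc.prems n by auto
    qed
    have IH2: "(\<Sum>q\<in>permutations_of_set (N - {a,b}). gap_cost m (map (x(j := x j + x a + x b)) q)) =
      fact (n - 2) * odd_expectation (N - {a,b}) (x(j := x j + x a + x b))"
      if ab: "a \<in> ?Y" "b \<in> ?Y - {a}" for a b
    proof -
      have c: "card (N - {a,b}) = n - 2"
        using ab Suc.prems(1) by (subst card_Diff_subset) (auto simp: n_def)
      have pos: "0 < (x(j := x j + x a + x b)) i" if "i \<in> N - {a,b}" for i
        using Suc.prems(3)[of j] Suc.prems(3)[of a] Suc.prems(3)[of b] Suc.prems(3)[of i] ab j that by auto
      have "finite (N - {a,b})" "card (N - {a,b}) = 2 * m" using Suc.prems(1) c n by auto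
      from Suc.IH[OF this pos] show ?thesis unfolding c .
    qed
    have one: "(\<Sum>i\<in>{i. i < n \<and> p ! i = j}. ?G) = ?G" if p: "p \<in> permutations_of_set N" for p
    proof -
      obtain i where "i < n" "p ! i = j" using len[OF p] j by (metis in_set_conv_nth)
      then have "{i. i < n \<and> p ! i = j} = {i}" using len[OF p] by (auto simp: nth_eq_iff_index_eq)
      then show ?thesis by simp
    qed
    have "(\<Sum>p\<in>permutations_of_set N. \<Sum>i\<in>{i. i < n \<and> p ! i = j}. ?h p i) =
      (\<Sum>p\<in>permutations_of_set N. ?G) +
      (\<Sum>p\<in>permutations_of_set N. \<Sum>i\<in>{i. i < n \<and> p ! i = j}. gap_cost m (merge_gap i (map x p)))"
      unfolding sum.distrib[symmetric] using one by (intro sum.cong) (auto simp: sum.distrib)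
    also have "\<dots> = fact n * ?G + fact (n - 2) * (2 * (\<Sum>a\<in>?Y. odd_expectation (N - {j,a}) x) +
       (\<Sum>a\<in>?Y. \<Sum>b\<in>?Y - {a}. odd_expectation (N - {a,b}) (x(j := x j + x a + x b))))"
    proof -
      have "(\<Sum>p\<in>permutations_of_set N. ?G) = fact n * ?G"
        using Suc.prems(1) by (simp add: n_def)
      moreover have "2 \<le> card N" using n by (simp add: n_def)
      note sum_merge_gap[OF Suc.prems(1) j(1) this, of "gap_cost m" x, folded n_def]
      ultimately show ?thesis using IH1 IH2 by (simp add: sum_distrib_left distrib_left mult.left_commute)
    qed
    also have "\<dots> = fact (n - 2) * (real n * (real n - 1) * odd_expectation N x)"
    proof -
      have f: "fact n = real n * (real n - 1) * (fact (n - 2) :: real)"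
        unfolding n by (simp add: algebra_simps)
      have "real n * (real n - 1) * odd_expectation N x = real n * (real n - 1) * x j +
        2 * (\<Sum>a\<in>?Y. odd_expectation (N - {j,a}) x) +
        (\<Sum>a\<in>?Y. \<Sum>b\<in>?Y - {a}. odd_expectation (N - {a,b}) (x(j := x j + x a + x b)))"
        unfolding n_def
      proof (rule odd_expectation_rec[OF Suc.prems(1) j(1)])
        show "even (card N)" using Suc.prems(2) by simp
        show "0 \<le> x i" if "i \<in> N" for i using Suc.prems(3)[OF that] by simp
        show "x j \<le> x i" if "i \<in> N" for i unfolding j(2) using Suc.prems(1) that by simp
      qed
      then show ?thesis unfolding f j(2)[symmetric] by (simp only: distrib_left mult.assoc mult.left_commute[of "fact (n - 2)"])
    qed
    also have "\<dots> = fact n * odd_expectation N x"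
      unfolding n by (simp add: algebra_simps)
    finally show "(\<Sum>p\<in>permutations_of_set N. \<Sum>i\<in>{i. i < n \<and> p ! i = j}. ?h p i) =
      fact n * odd_expectation N x" .
  qed simp
  finally show ?case using cM by (simp add: n_def)
qed

section \<open>The averages over set families\<close>

lemma finite_odd_parts: "finite (odd_parts k)"
proof (rule finite_subset)
  show "odd_parts k \<subseteq> mset ` {xs. set xs \<subseteq> {..k} \<and> length xs \<le> k}"
  proof
    fix oo assume oo: "oo \<in> odd_parts k"
    obtain xs where xs: "mset xs = oo" using ex_mset by blast
    have "set xs \<subseteq> {..k} \<and> length xs \<le> k"
    proof
      have sum: "sum_list xs = k" using oo xs[symmetric] by (simp add: odd_parts_def sum_mset_sum_list)
      show "set xs \<subseteq> {..k}"
        unfolding sum[symmetric] using member_le_sum_list[of _ xs] by auto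
      have "length xs = (\<Sum>i\<leftarrow>xs. 1)" by (simp add: sum_list_triv)
      also have "\<dots> \<le> (\<Sum>i\<leftarrow>xs. i)"
        using oo xs by (intro sum_list_mono) (auto simp: odd_parts_def Suc_le_eq odd_pos)
      finally show "length xs \<le> k" using sum by simp
    qed
    then show "oo \<in> mset ` {xs. set xs \<subseteq> {..k} \<and> length xs \<le> k}" using xs by auto
  qed
  show "finite (mset ` {xs. set xs \<subseteq> {..k} \<and> length xs \<le> k})"
    by (intro finite_imageI finite_lists_length_le) simp
qed

lemma Phi_member:
  assumes "F \<in> Phi n oo"
  shows "finite F" "\<And>S. S \<in> F \<Longrightarrow> finite S" "set_mset oo = card ` F"
    "(\<Sum>S\<in>F. card S) = sum_mset oo" "card (\<Union>F) = sum_mset oo"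
proof -
  have "F \<subseteq> Pow {1..n}" using assms by (auto simp: Phi_def)
  then show f: "finite F" by (rule finite_subset) simp
  show S: "\<And>S. S \<in> F \<Longrightarrow> finite S" using assms by (auto simp: Phi_def intro: finite_subset)
  show "set_mset oo = card ` F" using assms f by (auto simp: Phi_def)
  show s: "(\<Sum>S\<in>F. card S) = sum_mset oo" using assms by (auto simp: Phi_def sum_unfold_sum_mset)
  show "card (\<Union>F) = sum_mset oo"
    using assms S unfolding s[symmetric]
    by (subst card_Union_disjoint) (auto simp: Phi_def disjoint_def pairwise_def disjnt_def)
qed

lemma finite_Phi: "finite (Phi n oo)"
proof (rule finite_subset)
  show "Phi n oo \<subseteq> Pow (Pow {1..n})" by (auto simp: Phi_def)
qed simp

text \<open>Double counting of pairs of a family and a marked member of size \<open>i\<close>: mark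
  one of the \<open>count oo i + 1\<close> such members, or add an \<open>i\<close>-subset of the
  uncovered points. Since \<open>0 < i\<close>, a set disjoint from all members cannot already be
  one of them.\<close>

lemma card_Phi_add_mset:
  assumes "0 < i" "\<forall>l\<in>#oo. 0 < l"
  shows "(count oo i + 1) * card (Phi n (add_mset i oo)) = ((n - sum_mset oo) choose i) * card (Phi n oo)"
proof -
  let ?A = "Sigma (Phi n (add_mset i oo)) (\<lambda>F. {S \<in> F. card S = i})"
  let ?B = "Sigma (Phi n oo) (\<lambda>F. {S. S \<subseteq> {1..n} - \<Union>F \<and> card S = i})"
  have "card ?A = (\<Sum>F\<in>Phi n (add_mset i oo). card {S \<in> F. card S = i})"
    using Phi_member(1) finite_Phi by (subst card_SigmaI) auto
  also have "\<dots> = (\<Sum>F\<in>Phi n (add_mset i oo). count oo i + 1)"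
  proof (rule sum.cong)
    fix F assume F: "F \<in> Phi n (add_mset i oo)"
    have f: "finite F" using Phi_member(1)[OF F] .
    have "count (image_mset card (mset_set F)) i = count (add_mset i oo) i" using F by (simp add: Phi_def)
    moreover have "count (image_mset card (mset_set F)) i = card {S \<in> F. card S = i}"
      using f by (simp add: count_image_mset vimage_def Int_def conj_commute)
    ultimately show "card {S \<in> F. card S = i} = count oo i + 1" by simp
  qed simp
  finally have A: "card ?A = (count oo i + 1) * card (Phi n (add_mset i oo))" by simp
  have "card ?B = (\<Sum>F\<in>Phi n oo. card {S. S \<subseteq> {1..n} - \<Union>F \<and> card S = i})"
    using finite_Phi by (subst card_SigmaI) (auto intro: finite_subset[of _ "Pow {1..n}"])
  also have "\<dots> = (\<Sum>F\<in>Phi n oo. (n - sum_mset oo) choose i)"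
  proof (rule sum.cong)
    fix F assume F: "F \<in> Phi n oo"
    have "\<Union>F \<subseteq> {1..n}" using F by (auto simp: Phi_def)
    then have "card ({1..n} - \<Union>F) = n - sum_mset oo"
      using Phi_member(5)[OF F] by (simp add: card_Diff_subset finite_subset)
    then show "card {S. S \<subseteq> {1..n} - \<Union>F \<and> card S = i} = (n - sum_mset oo) choose i"
      by (simp add: n_subsets)
  qed simp
  finally have B: "card ?B = ((n - sum_mset oo) choose i) * card (Phi n oo)" by simp
  have "bij_betw (\<lambda>(F,S). (F - {S}, S)) ?A ?B"
  proof (rule bij_betw_byWitness[where f' = "\<lambda>(F,S). (insert S F, S)"])
    show "\<forall>z\<in>?A. (\<lambda>(F,S). (insert S F, S)) ((\<lambda>(F,S). (F - {S}, S)) z) = z" by (auto simp: insert_absorb)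
    have notin: "S \<notin> F" if "(F,S) \<in> ?B" for F S
    proof
      assume "S \<in> F"
      then have "S = {}" using that by auto
      then show False using that assms(1) by auto
    qed
    then show "\<forall>z\<in>?B. (\<lambda>(F,S). (F - {S}, S)) ((\<lambda>(F,S). (insert S F, S)) z) = z" by auto
    show "(\<lambda>(F,S). (F - {S}, S)) ` ?A \<subseteq> ?B"
    proof
      fix z assume "z \<in> (\<lambda>(F,S). (F - {S}, S)) ` ?A"
      then obtain F S where z: "z = (F - {S}, S)" "F \<in> Phi n (add_mset i oo)" "S \<in> F" "card S = i" by auto
      have f: "finite F" using Phi_member(1)[OF z(2)] .
      have "mset_set F = add_mset S (mset_set (F - {S}))" using f z(3) by (simp add: mset_set.remove)
      then have "add_mset i (image_mset card (mset_set (F - {S}))) = add_mset i oo"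
        using z(2,4) by (simp add: Phi_def)
      moreover have "T \<inter> S = {}" if "T \<in> F - {S}" for T
        using that z(2,3) disjointD[of F T S] by (auto simp: Phi_def)
      moreover have "disjoint (F - {S})" using z(2) by (auto simp: Phi_def disjoint_def)
      ultimately show "z \<in> ?B" using z by (auto simp: Phi_def)
    qed
    show "(\<lambda>(F,S). (insert S F, S)) ` ?B \<subseteq> ?A"
    proof
      fix z assume "z \<in> (\<lambda>(F,S). (insert S F, S)) ` ?B"
      then obtain F S where z: "z = (insert S F, S)" "F \<in> Phi n oo" "S \<subseteq> {1..n} - \<Union>F" "card S = i" by auto
      have f: "finite F" using Phi_member(1)[OF z(2)] .
      have "S \<notin> F" using notin[of F S] z by auto
      then have "image_mset card (mset_set (insert S F)) = add_mset i oo"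
        using f z by (simp add: Phi_def)
      moreover have "disjoint (insert S F)"
        using z(2,3) by (auto simp: Phi_def disjoint_def)
      ultimately show "z \<in> ?A" using z by (auto simp: Phi_def)
    qed
  qed
  from bij_betw_same_card[OF this] show ?thesis unfolding A B .
qed

text \<open>The multinomial count, built up one part at a time. The bound \<open>K\<close> is kept
  fixed so that the range of the product does not change during the induction.\<close>

lemma card_Phi:
  assumes "\<forall>l\<in>#oo. 0 < l \<and> l \<le> K" "sum_mset oo \<le> n"
  shows "card (Phi n oo) * (\<Prod>i\<in>{1..K}. fact i ^ count oo i * fact (count oo i)) * fact (n - sum_mset oo) = fact n"
  using assms
proof (induction oo)
  case empty
  have "F = {}" if "F \<in> Phi n {#}" for F
    using Phi_member(3)[OF that] by simp
  moreover have "{} \<in> Phi n {#}" by (simp add: Phi_def)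
  ultimately have "Phi n {#} = {{}}" by auto
  then show ?case by simp
next
  case (add i oo)
  let ?s = "sum_mset oo"
  let ?q = "\<lambda>oo l. fact l ^ count oo l * fact (count oo l) :: nat"
  have i: "0 < i" "i \<in> {1..K}" "i \<le> n - ?s" using add.prems by auto
  have "prod (?q (add_mset i oo)) {1..K} = ?q (add_mset i oo) i * prod (?q (add_mset i oo)) ({1..K} - {i})"
    using i by (intro prod.remove) auto
  also have "prod (?q (add_mset i oo)) ({1..K} - {i}) = prod (?q oo) ({1..K} - {i})"
    by (intro prod.cong) auto
  also have "?q (add_mset i oo) i = fact i * (count oo i + 1) * ?q oo i" by (simp add: algebra_simps)
  also have "fact i * (count oo i + 1) * ?q oo i * prod (?q oo) ({1..K} - {i}) =
      fact i * (count oo i + 1) * (?q oo i * prod (?q oo) ({1..K} - {i}))" by (simp only: mult.assoc)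
  also have "?q oo i * prod (?q oo) ({1..K} - {i}) = prod (?q oo) {1..K}"
    using i by (intro prod.remove[symmetric]) auto
  finally have q: "prod (?q (add_mset i oo)) {1..K} = fact i * (count oo i + 1) * prod (?q oo) {1..K}" .
  have c: "(count oo i + 1) * card (Phi n (add_mset i oo)) = ((n - ?s) choose i) * card (Phi n oo)"
    using add.prems by (intro card_Phi_add_mset) auto
  have "card (Phi n (add_mset i oo)) * prod (?q (add_mset i oo)) {1..K} * fact (n - sum_mset (add_mset i oo)) =
    ((count oo i + 1) * card (Phi n (add_mset i oo))) * prod (?q oo) {1..K} * (fact i * fact (n - ?s - i))"
    unfolding q by (simp add: algebra_simps)
  also have "\<dots> = card (Phi n oo) * prod (?q oo) {1..K} * (fact i * fact (n - ?s - i) * ((n - ?s) choose i))"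
    unfolding c by (simp only: mult_ac)
  also have "fact i * fact (n - ?s - i) * ((n - ?s) choose i) = fact (n - ?s)"
    using binomial_fact_lemma[OF i(3)] .
  also have "card (Phi n oo) * prod (?q oo) {1..K} * fact (n - ?s) = fact n"
    using add.IH add.prems by simp
  finally show ?case .
qed

lemma prod_mset_eq_prod_count:
  fixes g :: "nat \<Rightarrow> real"
  assumes "\<forall>l\<in>#oo. 0 < l \<and> l \<le> K"
  shows "prod_mset (image_mset g oo) = (\<Prod>i\<in>{1..K}. g i ^ count oo i)"
  using assms
proof (induction oo)
  case (add i oo)
  have "(\<Prod>l\<in>{1..K}. g l ^ count (add_mset i oo) l) = (\<Prod>l\<in>{1..K}. (if l = i then g i else 1) * g l ^ count oo l)"
    by (intro prod.cong) auto
  also have "\<dots> = g i * (\<Prod>l\<in>{1..K}. g l ^ count oo l)"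
    using add.prems by (subst prod.distrib) auto
  finally show ?case using add by simp
qed simp

text \<open>All families of type \<open>oo\<close> have the same weight. Writing
  \<open>fact i\<close> as \<open>i * fact (i - 1)\<close> splits the denominator of the multinomial
  count into the one of \<open>P_coef\<close> and the product \<open>?W\<close> of the numbers of
  cyclic orders.\<close>

lemma P_coef_f_avg:
  assumes "oo \<in> odd_parts k" "0 < k" "k \<le> n"
  shows "P_coef oo * f_avg n oo x =
    (\<Sum>F\<in>Phi n oo. fact (n - k) / fact n * (cycle_weight F / 2 * Min ((\<lambda>S. \<Sum>i\<in>S. x i) ` F)))"
proof -
  have s: "sum_mset oo = k" using assms(1) by (simp add: odd_parts_def)
  have el: "\<forall>l\<in>#oo. 0 < l \<and> l \<le> k"
  proof
    fix l assume l: "l \<in># oo"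
    then obtain M where "oo = add_mset l M" by (auto dest: multi_member_split)
    then show "0 < l \<and> l \<le> k" using assms(1) l s by (auto simp: odd_parts_def odd_pos)
  qed
  let ?A = "\<Prod>i\<in>{1..k}. real i ^ count oo i * fact (count oo i)"
  let ?W = "\<Prod>i\<in>{1..k}. fact (i - 1) ^ count oo i :: real"
  let ?Q = "\<Prod>i\<in>{1..k}. fact i ^ count oo i * fact (count oo i) :: nat"
  have "fact i = real i * fact (i - 1)" if "i \<in> {1..k}" for i
    using that by (simp add: fact_reduce)
  then have Q: "real ?Q = ?A * ?W"
    unfolding of_nat_prod prod.distrib[symmetric]
    by (intro prod.cong) (auto simp: power_mult_distrib)
  have "card (Phi n oo) * ?Q * fact (n - k) = fact n" using card_Phi[OF el] s assms(3) by simp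
  then have "real (card (Phi n oo) * ?Q * fact (n - k)) = real (fact n)" by simp
  then have cQ: "real (card (Phi n oo)) * (?A * ?W) * fact (n - k) = fact n"
    unfolding of_nat_mult Q by simp
  have nz: "?A \<noteq> 0" by auto
  have c0: "real (card (Phi n oo)) \<noteq> 0"
  proof
    assume "real (card (Phi n oo)) = 0"
    then have "fact n = (0::real)" unfolding cQ[symmetric] by (simp only: mult_zero_left)
    then show False by simp
  qed
  have W: "cycle_weight F / 2 = 2 ^ (size oo - 1) * ?W" if F: "F \<in> Phi n oo" for F
  proof -
    have "cycle_weight F = prod_mset (image_mset (\<lambda>i. 2 * fact (i - 1)) oo)"
      using F by (auto simp: cycle_weight_def prod_unfold_prod_mset Phi_def image_mset.compositionality o_def)
    also have "\<dots> = 2 ^ size oo * prod_mset (image_mset (\<lambda>i. fact (i - 1)) oo)"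
      by (induction oo) auto
    also have "prod_mset (image_mset (\<lambda>i. fact (i - 1)) oo) = ?W"
      by (rule prod_mset_eq_prod_count[OF el])
    finally have "cycle_weight F = 2 ^ size oo * ?W" .
    \<comment> \<open>With no parts, \<open>size oo - 1\<close> would be truncated and would not
      halve the power of 2.\<close>
    moreover have "size oo > 0" using s assms(2) by (cases oo) auto
    ultimately show ?thesis by (cases "size oo") auto
  qed
  have P: "P_coef oo / card (Phi n oo) = fact (n - k) / fact n * (2 ^ (size oo - 1) * ?W)"
  proof -
    \<comment> \<open>Here \<open>t\<close> is the power of 2, \<open>a\<close> the denominator of
      \<open>P_coef\<close>, \<open>c\<close> the number of families, \<open>w\<close> is
      \<open>?W\<close> and \<open>f\<close> is \<open>fact (n - k)\<close>.\<close>
    have gen: "t / a / c = f / (c * (a * w) * f) * (t * w)" if "a \<noteq> 0" "c \<noteq> 0" "w \<noteq> 0" "f \<noteq> 0" for t a c w f :: real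
      using that by (simp add: field_simps)
    have "?W \<noteq> 0" by simp
    then show ?thesis unfolding P_coef_def s cQ[symmetric] by (intro gen nz c0) simp_all
  qed
  have "P_coef oo * f_avg n oo x =
    P_coef oo / card (Phi n oo) * (\<Sum>F\<in>Phi n oo. Min ((\<lambda>S. \<Sum>i\<in>S. x i) ` F))"
    by (simp add: f_avg_def)
  also have "\<dots> = (\<Sum>F\<in>Phi n oo. fact (n - k) / fact n * (cycle_weight F / 2 * Min ((\<lambda>S. \<Sum>i\<in>S. x i) ` F)))"
    unfolding P sum_distrib_left by (intro sum.cong refl) (simp only: W mult.assoc)
  finally show ?thesis .
qed

section \<open>Grouping families by their sizes, and the final identity\<close>

lemma sum_odd_parts:
  assumes "0 < k" "k \<le> n"
  shows "(\<Sum>oo\<in>odd_parts k. P_coef oo * f_avg n oo x) = fact (n - k) / fact n * family_value {1..n} k x"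
proof -
  let ?h = "\<lambda>F. fact (n - k) / fact n * (cycle_weight F / 2 * Min ((\<lambda>S. \<Sum>i\<in>S. x i) ` F))"
  let ?t = "\<lambda>F. image_mset card (mset_set F)"
  have fin: "finite F" if "F \<in> odd_families {1..n} k" for F
    using that odd_families_finite_member by blast
  have "fact (n - k) / fact n * family_value {1..n} k x = sum ?h (odd_families {1..n} k)"
    by (simp only: family_value_def sum_distrib_left)
  also have "\<dots> = (\<Sum>oo\<in>odd_parts k. \<Sum>F\<in>{F \<in> odd_families {1..n} k. ?t F = oo}. ?h F)"
  proof (rule sum.group[symmetric])
    show "?t ` odd_families {1..n} k \<subseteq> odd_parts k"
    proof
      fix oo assume "oo \<in> ?t ` odd_families {1..n} k"
      then obtain F where F: "F \<in> odd_families {1..n} k" "oo = ?t F" by blast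
      then have "sum_mset oo = k" by (simp add: odd_families_def flip: sum_unfold_sum_mset)
      moreover have "odd i" if "i \<in># oo" for i
        using that F fin[OF F(1)] by (auto simp: odd_families_def)
      ultimately show "oo \<in> odd_parts k" by (simp add: odd_parts_def)
    qed
  qed (simp_all add: finite_odd_parts)
  also have "\<dots> = (\<Sum>oo\<in>odd_parts k. P_coef oo * f_avg n oo x)"
  proof (rule sum.cong)
    fix oo assume oo: "oo \<in> odd_parts k"
    have "{F \<in> odd_families {1..n} k. ?t F = oo} = Phi n oo"
    proof (intro equalityI subsetI)
      fix F assume F: "F \<in> Phi n oo"
      then have "odd (card S)" if "S \<in> F" for S
        using oo that Phi_member(3)[OF F] by (auto simp: odd_parts_def)
      then show "F \<in> {F \<in> odd_families {1..n} k. ?t F = oo}"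
        using F oo Phi_member(4)[OF F] by (auto simp: Phi_def odd_families_def odd_parts_def)
    qed (auto simp: Phi_def odd_families_def)
    then show "(\<Sum>F\<in>{F \<in> odd_families {1..n} k. ?t F = oo}. ?h F) = P_coef oo * f_avg n oo x"
      using P_coef_f_avg[OF oo assms] by simp
  qed simp
  finally show ?thesis ..
qed

lemma sum_permutes_eq_sum_permutations_of_set:
  fixes h :: "'a list \<Rightarrow> real"
  assumes "distinct xs"
  shows "(\<Sum>\<pi>\<in>{\<pi>. \<pi> permutes set xs}. h (map \<pi> xs)) = (\<Sum>p\<in>permutations_of_set (set xs). h p)"
proof -
  let ?S = "{\<pi>. \<pi> permutes set xs}" and ?m = "\<lambda>\<pi>. map \<pi> xs"
  have inj: "inj_on ?m ?S"
  proof (rule inj_onI)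
    fix \<pi> \<sigma> assume *: "\<pi> \<in> ?S" "\<sigma> \<in> ?S" "map \<pi> xs = map \<sigma> xs"
    show "\<pi> = \<sigma>"
    proof
      fix i show "\<pi> i = \<sigma> i"
        using * by (cases "i \<in> set xs") (simp_all add: permutes_not_in)
    qed
  qed
  have sub: "?m ` ?S \<subseteq> permutations_of_set (set xs)"
    using assms by (auto simp: permutations_of_set_def permutes_image distinct_map permutes_inj_on)
  \<comment> \<open>Surjectivity comes from comparing cardinalities: both sets have
    \<open>fact (length xs)\<close> elements.\<close>
  have "?m ` ?S = permutations_of_set (set xs)"
    by (intro card_subset_eq sub) (simp_all add: card_image[OF inj] card_permutations)
  then show ?thesis using sum.reindex[OF inj, of h] by simp
qed

theorem theoremA12:
  fixes n m :: nat and x :: "nat \<Rightarrow> real"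
  assumes "n = 2 * m" and "m > 0" and "\<forall>i\<in>{1..n}. x i > 0"
  shows "E_cost n x = (\<Sum>k\<in>{k. even k \<and> 2 \<le> k \<and> k \<le> n}. \<Sum>oo\<in>odd_parts k. P_coef oo * f_avg n oo x)"
proof -
  let ?xs = "[1..<n + 1]"
  have xs: "set ?xs = {1..n}" "distinct ?xs" by (auto simp del: upt_Suc)
  have "(\<Sum>\<pi>\<in>{\<pi>. \<pi> permutes {1..n}}. D_cost n (\<lambda>i. x (\<pi> i))) =
    (\<Sum>\<pi>\<in>{\<pi>. \<pi> permutes {1..n}}. gap_cost m (map x (map \<pi> ?xs)))"
  proof (rule sum.cong)
    fix \<pi> assume "\<pi> \<in> {\<pi>. \<pi> permutes {1..n}}"
    then have "0 < x (\<pi> i)" if "i \<in> {1..n}" for i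
      using that assms(3) by (metis mem_Collect_eq permutes_in_image)
    then show "D_cost n (\<lambda>i. x (\<pi> i)) = gap_cost m (map x (map \<pi> ?xs))"
      using D_cost_eq_gap_cost[OF assms(1), of "\<lambda>i. x (\<pi> i)"] by (simp add: o_def del: upt_Suc)
  qed simp
  also have "\<dots> = (\<Sum>p\<in>permutations_of_set {1..n}. gap_cost m (map x p))"
    using sum_permutes_eq_sum_permutations_of_set[OF xs(2), of "\<lambda>p. gap_cost m (map x p)"]
    unfolding xs(1) .
  also have "\<dots> = fact n * odd_expectation {1..n} x"
    using sum_gap_cost_permutations[of "{1..n}" m x] assms by simp
  finally have "E_cost n x = odd_expectation {1..n} x" by (simp add: E_cost_def)
  also have "\<dots> = (\<Sum>k\<in>{k. even k \<and> 2 \<le> k \<and> k \<le> n}. \<Sum>oo\<in>odd_parts k. P_coef oo * f_avg n oo x)"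
    unfolding odd_expectation_def by (intro sum.cong) (auto simp: sum_odd_parts)
  finally show ?thesis .
qed

end
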